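(* Let $\gamma>0$ and suppose $R\ge600(\gamma^{3/4}+\gamma^{-3/4})$. (i) $S_0(L_{\gamma,R})\ge\frac{\gamma R}{16\pi}\log R$. (ii) Let $0<\varepsilon<1$. If moreover $R\ge\frac4{e^2\gamma}(64\pi)^{2/\varepsilon}+1$, then $$S_\varepsilon(L_{\gamma,R})\ge\frac1{256\pi\varepsilon}\,\frac{(\gamma R)^{1+\varepsilon}}{\log^\varepsilon R}.$$
   Context: $L_{\gamma,R}=-\frac{d^2}{dx^2}+i\gamma\chi_{[0,R]}$ on $L^2(\mathbb{R}_+)$ with Dirichlet boundary condition at $0$. For an operator $H$ of this type and $\varepsilon\ge0$, $S_\varepsilon(H)=\sum_{\lambda\in\sigma_d(H)}\frac{\operatorname{dist}(\lambda,\mathbb{R}_+)}{|\lambda|^{(1-\varepsilon)/2}}$, where $\sigma_d(H)$ is the set of eigenvalues of finite algebraic multiplicity in $\mathbb{C}\setminus\mathbb{R}_+$, each repeated according to algebraic multiplicity. *)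

theory Defs
  imports "HOL-Analysis.Analysis"
begin

text \<open>Elements of L^2(R_+) are represented by functions real => complex;
  only their values on [0,\<infinity>) matter, and equality is almost-everywhere equality.\<close>

definition L2pos :: "(real \<Rightarrow> complex) \<Rightarrow> bool" where
  "L2pos f \<longleftrightarrow> f \<in> borel_measurable lborel \<and>
     integrable lborel (\<lambda>x. indicator {0..} x * (cmod (f x))\<^sup>2)"

definition ae_eq_pos :: "(real \<Rightarrow> complex) \<Rightarrow> (real \<Rightarrow> complex) \<Rightarrow> bool" where
  "ae_eq_pos f g \<longleftrightarrow> (AE x in lborel. x \<ge> 0 \<longrightarrow> f x = g x)"

text \<open>Domain of the Dirichlet Laplacian on the half line: H^2(R_+) with f(0)=0.
  f is C^1 on [0,\<infinity>) with derivative f', f' is absolutely continuous with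
  (weak) derivative g, and f, f', g are square integrable.\<close>

definition in_dom_D :: "(real \<Rightarrow> complex) \<Rightarrow> (real \<Rightarrow> complex) \<Rightarrow> (real \<Rightarrow> complex) \<Rightarrow> bool" where
  "in_dom_D f f' g \<longleftrightarrow> L2pos f \<and> L2pos f' \<and> L2pos g \<and>
     (\<forall>x\<ge>0. g integrable_on {0..x}) \<and>
     (\<forall>x\<ge>0. (f has_vector_derivative f' x) (at x within {0..})) \<and>
     (\<forall>x\<ge>0. f' x = f' 0 + integral {0..x} g) \<and>
     f 0 = 0"

text \<open>Graph of the operator L_{\<gamma>,R} = -d^2/dx^2 + i\<gamma>\<chi>_{[0,R]}: Lrel f h means f \<in> dom and L f = h (a.e.).\<close>

definition Lrel :: "real \<Rightarrow> real \<Rightarrow> (real \<Rightarrow> complex) \<Rightarrow> (real \<Rightarrow> complex) \<Rightarrow> bool" where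
  "Lrel \<gamma> R f h \<longleftrightarrow> (\<exists>f' g. in_dom_D f f' g \<and>
     ae_eq_pos h (\<lambda>x. - g x + \<i> * complex_of_real \<gamma> * indicator {0..R} x * f x))"

definition is_eigenvalue :: "real \<Rightarrow> real \<Rightarrow> complex \<Rightarrow> bool" where
  "is_eigenvalue \<gamma> R z \<longleftrightarrow> (\<exists>f. \<not> ae_eq_pos f (\<lambda>_. 0) \<and> Lrel \<gamma> R f (\<lambda>x. z * f x))"

text \<open>Generalized eigenvectors: f with (L - z)^n f = 0 for some n, i.e. a chain
  f = fs 0, (L-z) fs j = fs (j+1), fs n = 0.\<close>

definition gen_eigenspace :: "real \<Rightarrow> real \<Rightarrow> complex \<Rightarrow> (real \<Rightarrow> complex) set" where
  "gen_eigenspace \<gamma> R z = {f. \<exists>n fs. fs 0 = f \<and>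
      (\<forall>j<n. Lrel \<gamma> R (fs j) (\<lambda>x. fs (Suc j) x + z * fs j x)) \<and>
      ae_eq_pos (fs n) (\<lambda>_. 0)}"

definition lin_indep_pos :: "nat \<Rightarrow> (nat \<Rightarrow> real \<Rightarrow> complex) \<Rightarrow> bool" where
  "lin_indep_pos k fs \<longleftrightarrow> (\<forall>c :: nat \<Rightarrow> complex.
     ae_eq_pos (\<lambda>x. \<Sum>i<k. c i * fs i x) (\<lambda>_. 0) \<longrightarrow> (\<forall>i<k. c i = 0))"

definition indep_gen_counts :: "real \<Rightarrow> real \<Rightarrow> complex \<Rightarrow> nat set" where
  "indep_gen_counts \<gamma> R z = {k. \<exists>fs. (\<forall>i<k. fs i \<in> gen_eigenspace \<gamma> R z) \<and> lin_indep_pos k fs}"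

definition finite_alg_mult :: "real \<Rightarrow> real \<Rightarrow> complex \<Rightarrow> bool" where
  "finite_alg_mult \<gamma> R z \<longleftrightarrow> bdd_above (indep_gen_counts \<gamma> R z)"

definition alg_mult :: "real \<Rightarrow> real \<Rightarrow> complex \<Rightarrow> nat" where
  "alg_mult \<gamma> R z = Sup (indep_gen_counts \<gamma> R z)"

definition sigma_d :: "real \<Rightarrow> real \<Rightarrow> complex set" where
  "sigma_d \<gamma> R = {z. z \<notin> complex_of_real ` {0..} \<and> is_eigenvalue \<gamma> R z \<and> finite_alg_mult \<gamma> R z}"

definition S_eps :: "real \<Rightarrow> real \<Rightarrow> real \<Rightarrow> ennreal" where
  "S_eps \<epsilon> \<gamma> R = (\<Sum>\<^sub>\<infinity>z\<in>sigma_d \<gamma> R.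
      of_nat (alg_mult \<gamma> R z) *
      ennreal (infdist z (complex_of_real ` {0..}) / cmod z powr ((1 - \<epsilon>) / 2)))"

end

theory Submission
  imports Defs
begin

text \<open>A number \<open>z = k\<^sup>2\<close> with \<open>Im k > 0\<close> is an eigenvalue if \<open>\<kappa> cos (\<kappa> R) = i k sin (\<kappa> R)\<close>, where
  \<open>\<kappa>\<^sup>2 = z - i \<gamma>\<close>; the eigenfunction \<open>u\<close> is \<open>sin (\<kappa> x)\<close> continued by a decaying exponential.
  The integral of \<open>u\<^sup>2\<close> over the half line equals \<open>(R + i / k) / 2\<close> and does not vanish, which excludes
  Jordan chains, so every such eigenvalue is algebraically simple.

  With \<open>\<rho> = R sqrt \<gamma>\<close>, \<open>k = sqrt \<gamma> (w + i / w) / 2\<close> and \<open>\<kappa> = sqrt \<gamma> (w - i / w) / 2\<close> the eigenvalue condition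
  becomes \<open>w\<^sup>2 = i exp (2 i \<kappa> R)\<close>. Its logarithm is the fixed point equation
  \<open>w = \<alpha> + i / w - (2 i / \<rho>) Ln w\<close> with \<open>\<alpha> = (2 \<pi> n - \<pi> / 2) / \<rho>\<close>, which Brouwer's theorem solves in the disc of
  radius \<open>1/2\<close> about \<open>\<alpha>\<close> when \<open>6 \<le> \<alpha>\<close> and \<open>\<alpha> + 1/2 \<le> \<rho> / (2 ln \<rho>)\<close>. Distinct \<open>n\<close> give distinct
  eigenvalues with \<open>Im z \<ge> \<gamma> / 2\<close> and \<open>sqrt \<bar>z\<bar> \<le> sqrt \<gamma> (\<alpha> + 1) / 2\<close>, and comparing the resulting sum over
  \<open>n\<close> with an integral yields both bounds.\<close>

section \<open>Eigenfunctions and algebraic simplicity\<close>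

definition glue :: "real \<Rightarrow> (real \<Rightarrow> complex) \<Rightarrow> (real \<Rightarrow> complex) \<Rightarrow> real \<Rightarrow> complex" where
  "glue r a b x = (if x \<le> r then a x else b x)"

lemma glue_has_vector_derivative:
  assumes "\<And>x. (a has_vector_derivative a' x) (at x)" "\<And>x. (b has_vector_derivative b' x) (at x)"
    and "a r = b r" "a' r = b' r"
  shows "(glue r a b has_vector_derivative glue r a' b' x) (at x)"
proof -
  have "((\<lambda>x. if x \<in> {..r} then a x else b x) has_vector_derivative
      (if x \<in> {..r} then a' x else b' x)) (at x within UNIV)"
    by (rule has_vector_derivative_If_within_closures[where T = "{r..}"])
      (use assms in \<open>auto intro: has_vector_derivative_at_within dest: antisym\<close>)
  then show ?thesis
    by (simp add: glue_def[abs_def])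
qed

text \<open>Away from \<open>r\<close> the glued function agrees locally with one of its pieces, so
  nothing has to match at \<open>r\<close>. This serves the derivative of the eigenfunction, whose
  own derivative jumps with the potential at \<open>R\<close>.\<close>

lemma glue_has_vector_derivative_off:
  assumes "\<And>x. (a has_vector_derivative a' x) (at x)" "\<And>x. (b has_vector_derivative b' x) (at x)"
    and "x \<noteq> r"
  shows "(glue r a b has_vector_derivative glue r a' b' x) (at x)"
proof (cases "x < r")
  case True
  then show ?thesis
    using has_vector_derivative_transform_within_open[OF assms(1), of "{..<r}" x "glue r a b"]
    by (simp add: glue_def)
next
  case False
  then show ?thesis
    using assms has_vector_derivative_transform_within_open[OF assms(2), of "{r<..}" x "glue r a b"]
    by (simp add: glue_def)
qed

lemma continuous_on_glue:
  assumes "continuous_on UNIV a" "continuous_on UNIV b" "a r = b r"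
  shows "continuous_on UNIV (glue r a b)"
proof -
  have "continuous_on ({..r} \<union> {r..}) (\<lambda>x. if x \<le> r then a x else b x)"
    by (rule continuous_on_If)
      (use assms in \<open>auto intro: continuous_on_subset dest: antisym\<close>)
  moreover have "{..r} \<union> {r..} = (UNIV :: real set)" by auto
  ultimately show ?thesis
    by (simp add: glue_def[abs_def])
qed

lemma borel_measurable_glue:
  assumes "a \<in> borel_measurable borel" "b \<in> borel_measurable borel"
  shows "glue r a b \<in> borel_measurable borel"
  unfolding glue_def[abs_def] using assms by measurable

section \<open>Square integrability and almost everywhere equality\<close>

lemma L2pos_exp_decay:
  assumes "f \<in> borel_measurable borel" "0 < \<beta>"
    and "\<And>x. 0 \<le> x \<Longrightarrow> cmod (f x) \<le> M * exp (- \<beta> * x)"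
  shows "L2pos f"
  unfolding L2pos_def
proof (intro conjI)
  show "f \<in> borel_measurable lborel" using assms(1) by simp
  have "(\<lambda>x. exp (- (2 * \<beta>) * x)) absolutely_integrable_on {0..}"
    using integrable_on_exp_minus_to_infinity[of "2 * \<beta>" 0] assms(2)
    by (intro nonnegative_absolutely_integrable_1) auto
  \<comment> \<open>The improper integral is a statement about the completed measure; Borel
    measurability of the integrand brings it back to \<open>lborel\<close>.\<close>
  then have "integrable lborel (\<lambda>x. indicator {0..} x *\<^sub>R exp (- (2 * \<beta>) * x))"
    unfolding set_integrable_def
    by (subst (asm) integrable_completion) auto
  then have I: "integrable lborel (\<lambda>x. M\<^sup>2 * (indicator {0..} x *\<^sub>R exp (- (2 * \<beta>) * x)))"
    by (rule integrable_mult_right)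
  show "integrable lborel (\<lambda>x. indicator {0..} x * (cmod (f x))\<^sup>2)"
  proof (rule Bochner_Integration.integrable_bound[OF I])
    show "(\<lambda>x. indicator {0..} x * (cmod (f x))\<^sup>2) \<in> borel_measurable lborel"
      using assms(1) by measurable
    have "(cmod (f x))\<^sup>2 \<le> M\<^sup>2 * exp (- (2 * \<beta>) * x)" if "0 \<le> x" for x
    proof -
      have "(cmod (f x))\<^sup>2 \<le> (M * exp (- \<beta> * x))\<^sup>2"
        using assms(3)[OF that] by (intro power_mono) auto
      also have "\<dots> = M\<^sup>2 * exp (- (2 * \<beta>) * x)"
        by (simp add: power_mult_distrib power2_eq_square flip: exp_add)
      finally show ?thesis .
    qed
    then show "AE x in lborel. norm (indicator {0..} x * (cmod (f x))\<^sup>2)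
        \<le> norm (M\<^sup>2 * (indicator {0..} x *\<^sub>R exp (- (2 * \<beta>) * x)))"
      by (intro AE_I2) (auto simp: indicator_def)
  qed
qed

text \<open>The piece \<open>a\<close> is bounded on the compact interval \<open>{0..r}\<close>,
  where the exponential is at least 1, so the constant \<open>B + C\<close> serves as a common
  majorant on both sides of \<open>r\<close>.\<close>

lemma L2pos_glue_exp:
  assumes "continuous_on UNIV a" "0 < \<beta>" "0 \<le> r"
    and b: "b \<in> borel_measurable borel" "\<And>x. cmod (b x) \<le> C * exp (- \<beta> * (x - r))"
  shows "L2pos (glue r a b)"
proof -
  have "bounded (a ` {0..r})"
    using assms(1) by (intro compact_imp_bounded compact_continuous_image) (auto intro: continuous_on_subset)
  then obtain B where B: "\<And>x. 0 \<le> x \<Longrightarrow> x \<le> r \<Longrightarrow> cmod (a x) \<le> B" "0 < B"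
    unfolding bounded_pos by (metis atLeastAtMost_iff imageI)
  have C: "0 \<le> C"
    using order_trans[OF norm_ge_zero b(2)[of r]] by simp
  define M where "M = (B + C) * exp (\<beta> * r)"
  show ?thesis
  proof (rule L2pos_exp_decay[OF _ assms(2)])
    show "glue r a b \<in> borel_measurable borel"
      by (rule borel_measurable_glue[OF borel_measurable_continuous_onI[OF assms(1)] b(1)])
    fix x :: real assume x: "0 \<le> x"
    have M: "M * exp (- \<beta> * x) = (B + C) * exp (- \<beta> * (x - r))"
      by (simp add: M_def algebra_simps flip: exp_add)
    show "cmod (glue r a b x) \<le> M * exp (- \<beta> * x)"
    proof (cases "x \<le> r")
      case True
      have "cmod (a x) \<le> (B + C) * 1" using B(1)[OF x True] C by simp
      also have "\<dots> \<le> (B + C) * exp (- \<beta> * (x - r))"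
        using B C True assms(2) by (intro mult_left_mono) (auto simp: mult_nonneg_nonpos)
      finally show ?thesis using True M by (simp add: glue_def)
    next
      case False
      have "cmod (b x) \<le> C * exp (- \<beta> * (x - r))" by (rule b)
      also have "\<dots> \<le> (B + C) * exp (- \<beta> * (x - r))"
        using B by (intro mult_right_mono) auto
      finally show ?thesis using False M by (simp add: glue_def)
    qed
  qed
qed

lemma ae_eq_pos_obtain_negligible:
  assumes "ae_eq_pos f g"
  obtains N where "negligible N" "\<And>x. 0 \<le> x \<Longrightarrow> x \<notin> N \<Longrightarrow> f x = g x"
proof -
  obtain N where N: "{x \<in> space lborel. \<not> (0 \<le> x \<longrightarrow> f x = g x)} \<subseteq> N" "emeasure lborel N = 0" "N \<in> sets lborel"
    using assms unfolding ae_eq_pos_def by (rule AE_E)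
  then have "negligible N"
    by (simp add: negligible_iff_null_sets null_sets_completionI null_setsI)
  with N(1) that show ?thesis by auto
qed

lemma in_dom_D_D:
  assumes "in_dom_D f f' g"
  shows "L2pos f" "L2pos f'" "f 0 = 0"
    and "0 \<le> x \<Longrightarrow> g integrable_on {0..x}"
    and "0 \<le> x \<Longrightarrow> (f has_vector_derivative f' x) (at x within {0..})"
    and "0 \<le> x \<Longrightarrow> f' x = f' 0 + integral {0..x} g"
  using assms unfolding in_dom_D_def by blast+

section \<open>The eigenfunction attached to a pair of wave numbers\<close>

text \<open>Here \<open>\<kappa>\<close> is the wave number inside the barrier and \<open>k\<close>
  the one outside; \<open>dispersion\<close> says that both belong to the same spectral parameter
  \<open>k^2\<close>. \<open>Im_k\<close> gives decay at infinity, \<open>Im_\<kappa>\<close> keeps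
  the eigenfunction free of zeros on the open half line, and \<open>matching\<close> is continuity
  of its derivative at \<open>R\<close>.\<close>

locale barrier_mode =
  fixes \<gamma> R :: real and \<kappa> k :: complex
  assumes \<gamma>_pos: "0 < \<gamma>" and R_pos: "0 < R"
    and dispersion: "k\<^sup>2 = \<kappa>\<^sup>2 + \<i> * \<gamma>"
    and Im_k: "0 < Im k" and Im_\<kappa>: "Im \<kappa> \<noteq> 0"
    and matching: "\<kappa> * cos (\<kappa> * R) = \<i> * k * sin (\<kappa> * R)"
begin

definition u :: "real \<Rightarrow> complex" where
  "u = glue R (\<lambda>x. sin (\<kappa> * x)) (\<lambda>x. sin (\<kappa> * R) * exp (\<i> * k * (x - R)))"

definition u' :: "real \<Rightarrow> complex" where
  "u' = glue R (\<lambda>x. \<kappa> * cos (\<kappa> * x)) (\<lambda>x. \<i> * k * sin (\<kappa> * R) * exp (\<i> * k * (x - R)))"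

text \<open>At the jump point \<open>R\<close> the inner value is taken, in agreement with the
  closed interval in \<open>indicator {0..R}\<close>; hence \<open>u''_eq\<close> holds at every
  point of the half line.\<close>

definition u'' :: "real \<Rightarrow> complex" where
  "u'' = glue R (\<lambda>x. - \<kappa>\<^sup>2 * sin (\<kappa> * x)) (\<lambda>x. - k\<^sup>2 * sin (\<kappa> * R) * exp (\<i> * k * (x - R)))"

text \<open>This is the explicit primitive of \<open>u^2\<close> that vanishes at 0, that is, the
  integral of \<open>u^2\<close> over \<open>{0..x}\<close> for \<open>0 \<le> x\<close>.\<close>

definition U :: "real \<Rightarrow> complex" where
  "U = glue R (\<lambda>x. x / 2 - sin (2 * \<kappa> * x) / (4 * \<kappa>))
    (\<lambda>x. R / 2 - sin (2 * \<kappa> * R) / (4 * \<kappa>)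
      + (sin (\<kappa> * R))\<^sup>2 * (exp (2 * \<i> * k * (x - R)) - 1) / (2 * \<i> * k))"

lemma nonzero: "\<kappa> \<noteq> 0" "k \<noteq> 0"
  using Im_k Im_\<kappa> by auto

lemma u_deriv: "(u has_vector_derivative u' x) (at x)"
  unfolding u_def u'_def
  by (rule glue_has_vector_derivative)
    (auto intro!: derivative_eq_intros has_vector_derivative_real_field simp: matching)

lemma u'_deriv: "x \<noteq> R \<Longrightarrow> (u' has_vector_derivative u'' x) (at x)"
  unfolding u'_def u''_def
  by (rule glue_has_vector_derivative_off)
    (auto intro!: derivative_eq_intros has_vector_derivative_real_field simp: power2_eq_square algebra_simps)

lemma U_deriv: "(U has_vector_derivative (u x)\<^sup>2) (at x)"
proof -
  have cs: "1 / 2 - cos (2 * \<kappa> * x) / 2 = (sin (\<kappa> * x))\<^sup>2" for x :: real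
    using cos_double_sin[of "\<kappa> * x"] by (simp add: algebra_simps)
  have "(U has_vector_derivative glue R (\<lambda>x. (sin (\<kappa> * x))\<^sup>2)
      (\<lambda>x. (sin (\<kappa> * R))\<^sup>2 * exp (2 * \<i> * k * (x - R))) x) (at x)"
    unfolding U_def cs[symmetric]
    by (rule glue_has_vector_derivative)
      (use nonzero in \<open>auto intro!: derivative_eq_intros has_vector_derivative_real_field simp: field_simps\<close>)
  moreover have "glue R (\<lambda>x. (sin (\<kappa> * x))\<^sup>2)
      (\<lambda>x. (sin (\<kappa> * R))\<^sup>2 * exp (2 * \<i> * k * (x - R))) x = (u x)\<^sup>2"
    by (simp add: u_def glue_def power_mult_distrib algebra_simps flip: exp_double)
  ultimately show ?thesis by simp
qed

lemma u''_eq: "0 \<le> x \<Longrightarrow> u'' x = (\<i> * \<gamma> * indicator {0..R} x - k\<^sup>2) * u x"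
  using dispersion by (auto simp: u_def u''_def glue_def)

lemma u_at_0: "u 0 = 0" "U 0 = 0"
  using R_pos by (auto simp: u_def U_def glue_def)

lemma continuous_u: "continuous_on S u" and continuous_U: "continuous_on S U"
  using u_deriv U_deriv
  by (meson continuous_at_imp_continuous_on has_vector_derivative_continuous)+

lemma continuous_u': "continuous_on S u'"
proof -
  have "continuous_on UNIV u'"
    unfolding u'_def by (rule continuous_on_glue) (auto intro!: continuous_intros simp: matching)
  then show ?thesis by (rule continuous_on_subset) simp
qed

text \<open>The complex sine vanishes only at real multiples of pi, while \<open>\<kappa> x\<close>
  has nonzero imaginary part.\<close>

lemma sin_\<kappa>_nonzero: "0 < x \<Longrightarrow> sin (\<kappa> * of_real x) \<noteq> 0"
proof
  assume "0 < x" "sin (\<kappa> * of_real x) = 0"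
  then obtain n :: int where "\<kappa> * of_real x = of_real (n * pi)"
    unfolding sin_eq_0 by auto
  then have "Im (\<kappa> * of_real x) = 0" by simp
  with \<open>0 < x\<close> Im_\<kappa> show False by simp
qed

lemma u_nonzero: "0 < x \<Longrightarrow> u x \<noteq> 0"
  using sin_\<kappa>_nonzero R_pos by (auto simp: u_def glue_def)

lemma in_dom_D_u: "in_dom_D u u' u''"
proof -
  have decay: "cmod (A * sin (\<kappa> * R) * exp (\<i> * k * (x - R)))
      \<le> cmod (A * sin (\<kappa> * R)) * exp (- Im k * (x - R))" for A x
    by (simp add: norm_mult)
  have L2: "L2pos u" "L2pos u'" "L2pos u''"
    using decay[of 1] decay[of "\<i> * k"] decay[of "- k\<^sup>2"] R_pos Im_k
    unfolding u_def u'_def u''_def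
    by (auto intro!: L2pos_glue_exp[where \<beta> = "Im k"] continuous_intros borel_measurable_continuous_onI)
  \<comment> \<open>The fundamental theorem is applied with the exceptional point \<open>R\<close>,
    where \<open>u'\<close> is merely continuous.\<close>
  have FTC: "(u'' has_integral (u' x - u' 0)) {0..x}" if "0 \<le> x" for x
    by (rule fundamental_theorem_of_calculus_interior_strong[of "{R}"])
      (use that u'_deriv continuous_u' in auto)
  show ?thesis
    unfolding in_dom_D_def
    using L2 FTC u_deriv u_at_0 FTC[THEN integral_unique]
    by (auto intro: has_vector_derivative_at_within)
qed

lemma Lrel_u: "Lrel \<gamma> R u (\<lambda>x. k\<^sup>2 * u x)"
  unfolding Lrel_def ae_eq_pos_def
  by (intro exI[of _ u'] exI[of _ u''] conjI in_dom_D_u AE_I2) (auto simp: u''_eq algebra_simps)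

section \<open>The Wronskian identity and the absence of Jordan chains\<close>

text \<open>Lagrange's identity: if \<open>(L - k^2) f = c u\<close>, then the derivative of
  \<open>u f' - u' f\<close> is \<open>u f'' - u'' f = -c u^2\<close>, and the Wronskian vanishes at
  0 because \<open>u\<close> and \<open>f\<close> do.\<close>

lemma wronskian:
  assumes dom: "in_dom_D f f' g"
    and eq: "ae_eq_pos (\<lambda>x. c * u x + k\<^sup>2 * f x) (\<lambda>x. - g x + \<i> * complex_of_real \<gamma> * indicator {0..R} x * f x)"
    and "0 \<le> b"
  shows "u b * f' b - u' b * f b = - c * U b"
proof -
  \<comment> \<open>The weak second derivative \<open>g\<close> is determined only almost
    everywhere. The equation provides the representative \<open>h\<close>, which is continuous off
    \<open>R\<close>, so \<open>f'\<close> is classically differentiable there.\<close>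
  define h where "h x = (\<i> * \<gamma> * indicator {0..R} x - k\<^sup>2) * f x - c * u x" for x
  obtain N where N: "negligible N" and "\<And>x. 0 \<le> x \<Longrightarrow> x \<notin> N \<Longrightarrow>
      c * u x + k\<^sup>2 * f x = - g x + \<i> * complex_of_real \<gamma> * indicator {0..R} x * f x"
    using ae_eq_pos_obtain_negligible[OF eq] by blast
  then have gh: "g x = h x" if "0 \<le> x" "x \<notin> N" for x
    using that by (simp add: h_def algebra_simps)
  have f_deriv: "(f has_vector_derivative f' x) (at x within {0..})" if "0 \<le> x" for x
    using dom that by (rule in_dom_D_D)
  have f_cont: "continuous_on {0..} f"
    using f_deriv by (intro continuous_on_vector_derivative) auto
  have h_int: "h integrable_on {0..x}" and f'_eq: "f' x = f' 0 + integral {0..x} h" if "0 \<le> x" for x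
  proof -
    have "g integrable_on {0..x}" "f' x = f' 0 + integral {0..x} g"
      using in_dom_D_D(4,6)[OF dom that] by blast+
    moreover have "h integrable_on {0..x}"
      by (rule integrable_spike[OF \<open>g integrable_on {0..x}\<close> N]) (use gh in auto)
    moreover have "integral {0..x} g = integral {0..x} h"
      by (rule integral_spike[OF N]) (use gh in auto)
    ultimately show "h integrable_on {0..x}" "f' x = f' 0 + integral {0..x} h" by simp_all
  qed
  have h_cont: "isCont h x" if "0 < x" "x \<noteq> R" for x
  proof -
    have "continuous_on {0<..<R} h"
      by (rule continuous_on_eq[where f = "\<lambda>x. (\<i> * \<gamma> - k\<^sup>2) * f x - c * u x"])
        (auto intro!: continuous_intros continuous_on_subset[OF f_cont] continuous_u simp: h_def)
    moreover have "continuous_on {R<..} h"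
      by (rule continuous_on_eq[where f = "\<lambda>x. - k\<^sup>2 * f x - c * u x"])
        (use R_pos in \<open>auto intro!: continuous_intros continuous_on_subset[OF f_cont] continuous_u simp: h_def\<close>)
    ultimately show ?thesis
      using that continuous_on_interior[of "{0<..<R}" h x] continuous_on_interior[of "{R<..}" h x]
      by (cases "x < R") (auto simp: interior_open)
  qed
  have f'_deriv: "(f' has_vector_derivative h x) (at x)" if "0 < x" "x \<noteq> R" for x
  proof -
    have "((\<lambda>y. integral {0..y} h) has_vector_derivative h x) (at x within {0..x + 1} - {R})"
      by (rule integral_has_vector_derivative_continuous_at)
        (use that h_int h_cont in \<open>auto intro: continuous_at_imp_continuous_at_within\<close>)
    then have "((\<lambda>y. f' 0 + integral {0..y} h) has_vector_derivative h x) (at x within {0..x + 1} - {R})"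
      by (auto intro!: derivative_eq_intros)
    then have "((\<lambda>y. f' 0 + integral {0..y} h) has_vector_derivative h x) (at x within {0<..<x + 1} - {R})"
      by (rule has_vector_derivative_within_subset) auto
    then have "((\<lambda>y. f' 0 + integral {0..y} h) has_vector_derivative h x) (at x)"
      using that by (subst (asm) at_within_open) auto
    then show ?thesis
      by (rule has_vector_derivative_transform_within_open[of _ _ _ "{0<..}"])
        (use that in \<open>auto intro: f'_eq[symmetric]\<close>)
  qed
  have f'_cont: "continuous_on {0..b} f'"
  proof (rule continuous_on_eq)
    show "continuous_on {0..b} (\<lambda>x. f' 0 + integral {0..x} h)"
      using h_int[OF assms(3)] by (intro continuous_intros indefinite_integral_continuous_1)
  qed (use f'_eq in \<open>metis atLeastAtMost_iff\<close>)
  define w where "w x = u x * f' x - u' x * f x + c * U x" for x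
  have "(w has_vector_derivative 0) (at x)" if "x \<in> {0<..<b} - {R}" for x
  proof -
    have "(f has_vector_derivative f' x) (at x within {0<..})"
      using f_deriv[of x] that by (auto intro: has_vector_derivative_within_subset)
    then have "(f has_vector_derivative f' x) (at x)"
      using that by (subst (asm) at_within_open) auto
    moreover have "u'' x = (\<i> * \<gamma> * indicator {0..R} x - k\<^sup>2) * u x"
      using that by (intro u''_eq) auto
    moreover have "(w has_vector_derivative (u x * h x + u' x * f' x) - (u' x * f' x + u'' x * f x)
        + c * (u x)\<^sup>2) (at x)"
      unfolding w_def using that calculation(1)
      by (intro has_vector_derivative_add has_vector_derivative_diff has_vector_derivative_mult
          has_vector_derivative_mult_right u_deriv u'_deriv f'_deriv U_deriv) auto
    ultimately have "(w has_vector_derivative (u x * h x + u' x * f' x) - (u' x * f' x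
        + (\<i> * \<gamma> * indicator {0..R} x - k\<^sup>2) * u x * f x) + c * (u x)\<^sup>2) (at x)"
      by simp
    then show ?thesis
      by (simp add: h_def algebra_simps power2_eq_square)
  qed
  moreover have "continuous_on {0..b} w"
    unfolding w_def
    by (intro continuous_intros continuous_u continuous_u' continuous_U f'_cont continuous_on_subset[OF f_cont]) auto
  \<comment> \<open>A continuous function with zero derivative off the single point \<open>R\<close>
    is constant.\<close>
  ultimately have "((\<lambda>_. 0) has_integral (w b - w 0)) {0..b}"
    using assms(3) by (intro fundamental_theorem_of_calculus_interior_strong[of "{R}"]) auto
  then have "w b - w 0 = 0"
    by (rule has_integral_unique) (rule has_integral_0)
  then have "w b = w 0" by simp
  also have "\<dots> = 0"
    using in_dom_D_D(3)[OF dom] by (simp add: w_def u_at_0)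
  finally show ?thesis by (simp add: w_def algebra_simps add_eq_0_iff)
qed

text \<open>The exponential term dies out at infinity. The remaining constant is simplified by
  squaring \<open>matching\<close>, which with \<open>dispersion\<close> gives
  \<open>s^2 = \<i> \<kappa>^2 / \<gamma>\<close> and then
  \<open>sin (2 \<kappa> R) = -2 k \<kappa> / \<gamma>\<close>.\<close>

lemma U_tendsto: "(U \<longlongrightarrow> (R + \<i> / k) / 2) at_top"
proof -
  define s where "s = sin (\<kappa> * R)"
  have "\<kappa>\<^sup>2 * (cos (\<kappa> * R))\<^sup>2 = - k\<^sup>2 * s\<^sup>2"
    using arg_cong[OF matching, of "\<lambda>z. z\<^sup>2"] by (simp add: power_mult_distrib s_def)
  then have "\<kappa>\<^sup>2 * (1 - s\<^sup>2) = - k\<^sup>2 * s\<^sup>2"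
    by (simp add: cos_squared_eq s_def)
  then have "\<kappa>\<^sup>2 = - \<i> * \<gamma> * s\<^sup>2"
    using dispersion by (simp add: algebra_simps)
  then have s2: "s\<^sup>2 = \<i> * \<kappa>\<^sup>2 / \<gamma>"
    using \<gamma>_pos by (simp add: field_simps)
  have "sin (2 * \<kappa> * R) = 2 * s * cos (\<kappa> * R)"
    using sin_double[of "\<kappa> * R"] by (simp add: s_def mult.assoc)
  then have "\<kappa> * sin (2 * \<kappa> * R) = 2 * \<i> * k * s\<^sup>2"
    using matching by (simp add: s_def power2_eq_square)
  also have "\<dots> = - 2 * k * \<kappa>\<^sup>2 / \<gamma>"
    by (simp add: s2 mult_ac flip: mult.assoc[of \<i> \<i>])
  finally have "\<kappa> * sin (2 * \<kappa> * R) = \<kappa> * (- 2 * k * \<kappa> / \<gamma>)"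
    by (simp add: power2_eq_square)
  then have s\<kappa>: "sin (2 * \<kappa> * R) = - 2 * k * \<kappa> / \<gamma>"
    using nonzero by (subst (asm) mult_cancel_left) auto
  have "R / 2 - sin (2 * \<kappa> * R) / (4 * \<kappa>) + s\<^sup>2 * (0 - 1) / (2 * \<i> * k)
      = (R + (k\<^sup>2 - \<kappa>\<^sup>2) / (\<gamma> * k)) / 2"
    using nonzero \<gamma>_pos unfolding s\<kappa> s2 by (simp add: field_simps power2_eq_square)
  also have "\<dots> = (R + \<i> / k) / 2"
    using nonzero \<gamma>_pos by (simp add: dispersion)
  finally have lim: "R / 2 - sin (2 * \<kappa> * R) / (4 * \<kappa>) + s\<^sup>2 * (0 - 1) / (2 * \<i> * k) = (R + \<i> / k) / 2" .
  have "((\<lambda>x. exp (- (2 * Im k) * (x - R))) \<longlongrightarrow> 0) at_top"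
  proof (rule filterlim_compose[OF exp_at_bot])
    have "filterlim (\<lambda>x. - R + x) at_top at_top"
      by (rule filterlim_tendsto_add_at_top[OF tendsto_const filterlim_ident])
    then have "filterlim (\<lambda>x. x - R) at_top at_top" by simp
    then show "LIM x at_top. - (2 * Im k) * (x - R) :> at_bot"
      using Im_k by (intro filterlim_tendsto_neg_mult_at_bot[OF tendsto_const]) auto
  qed
  then have "((\<lambda>x::real. exp (2 * \<i> * k * (x - R))) \<longlongrightarrow> 0) at_top"
    by (rule tendsto_norm_zero_cancel[OF Lim_transform_eventually]) (simp add: mult_ac)
  then have "((\<lambda>x::real. R / 2 - sin (2 * \<kappa> * R) / (4 * \<kappa>) + s\<^sup>2 * (exp (2 * \<i> * k * (x - R)) - 1) / (2 * \<i> * k))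
      \<longlongrightarrow> R / 2 - sin (2 * \<kappa> * R) / (4 * \<kappa>) + s\<^sup>2 * (0 - 1) / (2 * \<i> * k)) at_top"
    using nonzero by (intro tendsto_intros) auto
  then show ?thesis
    unfolding lim
    by (rule Lim_transform_eventually)
      (use eventually_gt_at_top[of R] in eventually_elim, simp add: U_def glue_def s_def)
qed

text \<open>Vanishing would force \<open>k = -\<i> / R\<close>, a point of the lower half
  plane.\<close>

lemma U_limit_nonzero: "R + \<i> / k \<noteq> 0"
proof
  assume "R + \<i> / k = 0"
  then have "k * R = - \<i>"
    using nonzero by (simp add: field_simps add_eq_0_iff)
  then have "Im (k * R) = - 1" by simp
  then have "Im k * R = - 1" by simp
  with mult_pos_pos[OF Im_k R_pos] show False by simp
qed

text \<open>The Wronskian of two functions in the domain is integrable, hence cannot have a nonzero limit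
  at infinity; the limit it would have is \<open>-c\<close> times
  the integral of \<open>u\<^sup>2\<close> over the half line, which is nonzero because \<open>Im k > 0\<close>.\<close>

lemma no_jordan_chain:
  assumes dom: "in_dom_D f f' g"
    and eq: "ae_eq_pos (\<lambda>x. c * u x + k\<^sup>2 * f x) (\<lambda>x. - g x + \<i> * complex_of_real \<gamma> * indicator {0..R} x * f x)"
  shows "c = 0"
proof (rule ccontr)
  assume c: "c \<noteq> 0"
  define \<delta> where "\<delta> = cmod (c * ((R + \<i> / k) / 2)) / 2"
  have \<delta>: "0 < \<delta>" "\<delta> < cmod (c * ((R + \<i> / k) / 2))"
    using c U_limit_nonzero by (auto simp: \<delta>_def)
  have "((\<lambda>x. cmod (c * U x)) \<longlongrightarrow> cmod (c * ((R + \<i> / k) / 2))) at_top"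
    by (intro tendsto_intros U_tendsto)
  then have "\<forall>\<^sub>F x in at_top. \<delta> < cmod (c * U x)"
    using \<delta>(2) by (rule order_tendstoD)
  then obtain x0 where "\<And>x. x \<ge> x0 \<Longrightarrow> \<delta> < cmod (c * U x)"
    by (auto simp: eventually_at_top_linorder)
  then have x1: "\<delta> < cmod (c * U x)" if "x \<ge> max 0 x0" for x
    using that by simp
  define x1 where "x1 = max 0 x0"
  have x1: "0 \<le> x1" "\<And>x. x \<ge> x1 \<Longrightarrow> \<delta> < cmod (c * U x)"
    using x1 by (auto simp: x1_def)
  let ?F = "\<lambda>x. indicator {0..} x * (cmod (u x))\<^sup>2 + indicator {0..} x * (cmod (u' x))\<^sup>2
      + (indicator {0..} x * (cmod (f x))\<^sup>2 + indicator {0..} x * (cmod (f' x))\<^sup>2)"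
  have int: "integrable lborel ?F"
    using in_dom_D_D(1,2)[OF dom] in_dom_D_D(1,2)[OF in_dom_D_u] unfolding L2pos_def
    by (intro Bochner_Integration.integrable_add) auto
  have "integrable lborel (\<lambda>x. indicator {x1..} x * \<delta>)"
  proof (rule Bochner_Integration.integrable_bound[OF int])
    have "\<delta> \<le> ?F x" if "x1 \<le> x" for x
    proof -
      have "\<delta> \<le> cmod (u x * f' x - u' x * f x)"
        using x1 that wronskian[OF dom eq, of x] by (simp add: less_imp_le norm_mult)
      also have "\<dots> \<le> cmod (u x) * cmod (f' x) + cmod (u' x) * cmod (f x)"
        by (metis norm_mult norm_triangle_ineq4)
      also have "\<dots> \<le> (cmod (u x))\<^sup>2 + (cmod (u' x))\<^sup>2 + ((cmod (f x))\<^sup>2 + (cmod (f' x))\<^sup>2)"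
        using sum_squares_bound[of "cmod (u x)" "cmod (f' x)"] sum_squares_bound[of "cmod (u' x)" "cmod (f x)"]
          mult_nonneg_nonneg[OF norm_ge_zero[of "u x"] norm_ge_zero[of "f' x"]]
          mult_nonneg_nonneg[OF norm_ge_zero[of "u' x"] norm_ge_zero[of "f x"]]
        by linarith
      finally show ?thesis
        using that x1(1) by simp
    qed
    then show "AE x in lborel. norm (indicator {x1..} x * \<delta>) \<le> norm (?F x)"
      using \<delta>(1) by (intro AE_I2) (auto simp: indicator_def)
  qed simp
  then have "integrable lborel (\<lambda>x. indicator {x1..} x :: real)"
    using \<delta>(1) by simp
  then have "emeasure lborel {x1..} < \<infinity>"
    by (simp add: integrable_indicator_iff)
  moreover have "emeasure lborel {x1..} = \<infinity>"
  proof (rule ccontr)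
    assume "emeasure lborel {x1..} \<noteq> \<infinity>"
    then obtain M where M: "0 \<le> M" "emeasure lborel {x1..} = ennreal M"
      by (cases "emeasure lborel {x1..}") auto
    have "emeasure lborel {x1..x1 + (M + 1)} \<le> emeasure lborel {x1..}"
      by (intro emeasure_mono) auto
    then show False
      using M by (simp add: ennreal_le_iff)
  qed
  ultimately show False by simp
qed

text \<open>For \<open>c = 0\<close> the Wronskian of \<open>u\<close> and \<open>f\<close> vanishes
  identically, so \<open>f / u\<close> has zero derivative on the open half line, where
  \<open>u\<close> has no zeros.\<close>

lemma eigenfunction_unique:
  assumes "Lrel \<gamma> R f (\<lambda>x. k\<^sup>2 * f x)"
  obtains d where "\<And>x. 0 < x \<Longrightarrow> f x = d * u x"
proof -
  obtain f' g where dom: "in_dom_D f f' g" and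
    eq: "ae_eq_pos (\<lambda>x. k\<^sup>2 * f x) (\<lambda>x. - g x + \<i> * complex_of_real \<gamma> * indicator {0..R} x * f x)"
    using assms by (auto simp: Lrel_def)
  have W: "u x * f' x = u' x * f x" if "0 \<le> x" for x
  proof -
    have "ae_eq_pos (\<lambda>x. 0 * u x + k\<^sup>2 * f x) (\<lambda>x. - g x + \<i> * complex_of_real \<gamma> * indicator {0..R} x * f x)"
      using eq by simp
    from wronskian[OF dom this that] show ?thesis by simp
  qed
  have "((\<lambda>x. f x / u x) has_vector_derivative 0) (at x within {0<..})" if "x \<in> {0<..}" for x
  proof -
    have "(f has_vector_derivative f' x) (at x within {0<..})"
      by (rule has_vector_derivative_within_subset[of _ _ _ "{0..}"])
        (use in_dom_D_D(5)[OF dom, of x] that in auto)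
    moreover have "(u has_vector_derivative u' x) (at x within {0<..})"
      by (rule has_vector_derivative_at_within[OF u_deriv])
    ultimately have "((\<lambda>x. f x / u x) has_derivative
        (\<lambda>h. (h *\<^sub>R f' x * u x - f x * h *\<^sub>R u' x) / (u x * u x))) (at x within {0<..})"
      using that u_nonzero unfolding has_vector_derivative_def by (intro has_derivative_divide') auto
    moreover have "f' x * u x = f x * u' x"
      using W[of x] that by (simp add: mult.commute)
    ultimately show ?thesis
      by (simp add: has_vector_derivative_def)
  qed
  then obtain d where "\<And>x. x \<in> {0<..} \<Longrightarrow> f x / u x = d"
    using has_vector_derivative_zero_constant[of "{0<..}" "\<lambda>x. f x / u x"] by (metis convex_real_interval(3))
  then have "f x = d * u x" if "0 < x" for x
    using u_nonzero[OF that] that by (metis greaterThan_iff nonzero_divide_eq_eq)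
  then show ?thesis by (rule that)
qed

section \<open>The generalized eigenspace is one-dimensional\<close>

lemma AE_pos: "(AE x in lborel. 0 \<le> x \<longrightarrow> P x) \<longleftrightarrow> (AE x in lborel. 0 < (x::real) \<longrightarrow> P x)"
proof -
  have ae: "AE x in lborel. x \<noteq> (0::real)" by (rule AE_lborel_singleton)
  show ?thesis
  proof
    assume "AE x in lborel. 0 \<le> x \<longrightarrow> P x"
    then show "AE x in lborel. 0 < x \<longrightarrow> P x" by eventually_elim simp
  next
    assume "AE x in lborel. 0 < x \<longrightarrow> P x"
    with ae show "AE x in lborel. 0 \<le> x \<longrightarrow> P x" by eventually_elim simp
  qed
qed

text \<open>Induction on the length of the chain: its tail shows that \<open>fs 1\<close> is a
  multiple \<open>c u\<close>, \<open>no_jordan_chain\<close> forces \<open>c = 0\<close>, and so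
  \<open>fs 0\<close> solves the eigenvalue equation itself.\<close>

lemma chain_multiple:
  assumes "\<forall>j<n. Lrel \<gamma> R (fs j) (\<lambda>x. fs (Suc j) x + k\<^sup>2 * fs j x)" "ae_eq_pos (fs n) (\<lambda>_. 0)"
  shows "\<exists>d. ae_eq_pos (fs 0) (\<lambda>x. d * u x)"
  using assms
proof (induction n arbitrary: fs)
  case 0
  then show ?case by (intro exI[of _ 0]) simp
next
  case (Suc n)
  obtain c where c: "ae_eq_pos (fs 1) (\<lambda>x. c * u x)"
    using Suc.IH[of "\<lambda>j. fs (Suc j)"] Suc.prems by auto
  obtain f' g where dom: "in_dom_D (fs 0) f' g" and
    "ae_eq_pos (\<lambda>x. fs 1 x + k\<^sup>2 * fs 0 x) (\<lambda>x. - g x + \<i> * complex_of_real \<gamma> * indicator {0..R} x * fs 0 x)"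
    using Suc.prems(1) by (auto simp: Lrel_def)
  then have eq: "ae_eq_pos (\<lambda>x. c * u x + k\<^sup>2 * fs 0 x) (\<lambda>x. - g x + \<i> * complex_of_real \<gamma> * indicator {0..R} x * fs 0 x)"
    using c unfolding ae_eq_pos_def by eventually_elim simp
  with no_jordan_chain[OF dom eq] have "Lrel \<gamma> R (fs 0) (\<lambda>x. k\<^sup>2 * fs 0 x)"
    using dom by (auto simp: Lrel_def)
  then obtain d where "\<And>x. 0 < x \<Longrightarrow> fs 0 x = d * u x"
    by (rule eigenfunction_unique) blast
  then show ?case
    unfolding ae_eq_pos_def AE_pos by auto
qed

lemma not_ae_zero_u:
  assumes "ae_eq_pos (\<lambda>x. d * u x) (\<lambda>_. 0)"
  shows "d = 0"
proof (rule ccontr)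
  assume "d \<noteq> 0"
  have "AE x in lborel. \<not> 0 < (x::real)"
    using assms unfolding ae_eq_pos_def AE_pos
    by eventually_elim (use \<open>d \<noteq> 0\<close> u_nonzero in auto)
  then have "AE x in lborel. x \<notin> {0<..<1::real}"
    by eventually_elim simp
  then have "{0<..<1::real} \<in> null_sets lborel"
    by (subst AE_iff_null_sets) auto
  then have "emeasure lborel {0<..<1::real} = 0" by auto
  then show False by simp
qed

lemma gen_eigenspace_multiple:
  assumes "f \<in> gen_eigenspace \<gamma> R (k\<^sup>2)"
  shows "\<exists>d. ae_eq_pos f (\<lambda>x. d * u x)"
  using assms chain_multiple by (fastforce simp: gen_eigenspace_def)

lemma u_in_gen_eigenspace: "u \<in> gen_eigenspace \<gamma> R (k\<^sup>2)"
  unfolding gen_eigenspace_def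
  by (rule CollectI, rule exI[of _ 1], rule exI[of _ "\<lambda>j. if j = 0 then u else (\<lambda>_. 0)"])
    (use Lrel_u in \<open>auto simp: ae_eq_pos_def\<close>)

lemma indep_gen_counts_le_1:
  assumes "m \<in> indep_gen_counts \<gamma> R (k\<^sup>2)"
  shows "m \<le> 1"
proof (rule ccontr)
  assume "\<not> m \<le> 1"
  obtain fs where fs: "\<forall>i<m. fs i \<in> gen_eigenspace \<gamma> R (k\<^sup>2)" and indep: "lin_indep_pos m fs"
    using assms by (auto simp: indep_gen_counts_def)
  obtain d0 d1 where d: "ae_eq_pos (fs 0) (\<lambda>x. d0 * u x)" "ae_eq_pos (fs 1) (\<lambda>x. d1 * u x)"
    using fs gen_eigenspace_multiple \<open>\<not> m \<le> 1\<close> by (metis not_le less_trans zero_less_one)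
  have dep: "a = 0 \<and> b = 0" if "a * d0 + b * d1 = 0" for a b
  proof -
    define c where "c i = (if i = 0 then a else if i = Suc 0 then b else 0)" for i :: nat
    have "(\<Sum>i<m. c i * fs i x) = (\<Sum>i\<in>{0, Suc 0}. c i * fs i x)" for x
      by (rule sum.mono_neutral_right) (use \<open>\<not> m \<le> 1\<close> in \<open>auto simp: c_def\<close>)
    then have sum: "(\<Sum>i<m. c i * fs i x) = a * fs 0 x + b * fs 1 x" for x
      by (simp add: c_def)
    have lin: "a * (d0 * v) + b * (d1 * v) = 0" for v
      using that by (metis distrib_right mult.assoc mult_zero_left)
    have "ae_eq_pos (\<lambda>x. \<Sum>i<m. c i * fs i x) (\<lambda>_. 0)"
      using d unfolding sum ae_eq_pos_def by eventually_elim (simp add: lin)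
    with indep \<open>\<not> m \<le> 1\<close> have "c 0 = 0" "c 1 = 0"
      by (auto simp: lin_indep_pos_def)
    then show ?thesis by (simp add: c_def)
  qed
  \<comment> \<open>The relation \<open>d1 (d0 u) - d0 (d1 u) = 0\<close> forces both coefficients
    to vanish; then \<open>fs 0\<close> is almost everywhere zero and the relation with coefficients
    1 and 0 is a contradiction.\<close>
  from dep[of d1 "- d0"] have "d0 = 0" "d1 = 0" by (auto simp: mult.commute)
  with dep[of 1 0] show False by simp
qed

lemma one_in_indep_gen_counts: "1 \<in> indep_gen_counts \<gamma> R (k\<^sup>2)"
  unfolding indep_gen_counts_def
  by (rule CollectI, rule exI[of _ "\<lambda>_. u"])
    (use u_in_gen_eigenspace not_ae_zero_u in \<open>auto simp: lin_indep_pos_def\<close>)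

lemma finite_alg_mult: "finite_alg_mult \<gamma> R (k\<^sup>2)"
  using indep_gen_counts_le_1 by (auto simp: finite_alg_mult_def bdd_above_def)

lemma alg_mult: "alg_mult \<gamma> R (k\<^sup>2) = 1"
  unfolding alg_mult_def
  using one_in_indep_gen_counts indep_gen_counts_le_1 by (rule cSup_eq_maximum)

lemma is_eigenvalue: "is_eigenvalue \<gamma> R (k\<^sup>2)"
  unfolding is_eigenvalue_def
  using Lrel_u not_ae_zero_u[of 1] by (intro exI[of _ u]) auto

end

section \<open>Solutions of the eigenvalue condition\<close>

text \<open>The disc lies in \<open>Re w \<ge> 11/2\<close>, where \<open>Ln\<close> is continuous.
  There \<open>1 / w\<close> has modulus at most 2/11 and the logarithmic term at most 2/13 + 4/750;
  the sum is below the radius 1/2, so Brouwer's theorem applies.\<close>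

lemma fixed_point_exists:
  fixes \<rho> \<alpha> :: real
  assumes \<rho>: "750 \<le> \<rho>" and \<alpha>: "6 \<le> \<alpha>" "(\<alpha> + 1 / 2) * ln \<rho> \<le> \<rho> / 2"
  obtains w :: complex where "cmod (w - \<alpha>) \<le> 1 / 2" "w = \<alpha> + \<i> / w - 2 * \<i> / \<rho> * Ln w"
proof -
  have ln\<rho>: "1 \<le> ln \<rho>"
    using \<rho> exp_le by (subst ln_ge_iff) auto
  have le: "\<alpha> + 1 / 2 \<le> \<rho>"
  proof -
    have "\<alpha> + 1 / 2 \<le> (\<alpha> + 1 / 2) * ln \<rho>"
      using mult_left_mono[OF ln\<rho>, of "\<alpha> + 1 / 2"] \<alpha>(1) by simp
    then show ?thesis using \<alpha>(2) \<rho> by linarith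
  qed
  have small: "2 / \<rho> * ln \<rho> \<le> 2 / 13"
  proof -
    \<comment> \<open>13/2 is the least possible value of \<open>\<alpha> + 1/2\<close>.\<close>
    have "(13 / 2) * ln \<rho> \<le> (\<alpha> + 1 / 2) * ln \<rho>"
      using \<alpha>(1) ln\<rho> by (intro mult_right_mono) auto
    then have "13 * ln \<rho> \<le> \<rho>" using \<alpha>(2) by linarith
    then show ?thesis using \<rho> by (simp add: field_simps)
  qed
  define S where "S = cball (complex_of_real \<alpha>) (1 / 2)"
  define F where "F w = of_real \<alpha> + \<i> / w - 2 * \<i> / of_real \<rho> * Ln w" for w
  have w: "0 < Re w" "w \<noteq> 0" "11 / 2 \<le> cmod w" "cmod w \<le> \<rho>" if "w \<in> S" for w
  proof -
    have d: "cmod (w - \<alpha>) \<le> 1 / 2"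
      using that by (simp add: S_def dist_norm norm_minus_commute)
    have "\<alpha> - 1 / 2 \<le> Re w"
      using abs_Re_le_cmod[of "w - \<alpha>"] d by simp
    then show "0 < Re w" and "11 / 2 \<le> cmod w"
      using \<alpha>(1) complex_Re_le_cmod[of w] by linarith+
    then show "w \<noteq> 0" by auto
    have "cmod w \<le> cmod (w - \<alpha>) + \<alpha>"
      using norm_triangle_ineq[of "w - \<alpha>" "of_real \<alpha>"] \<alpha>(1) by simp
    then show "cmod w \<le> \<rho>" using d le by linarith
  qed
  have "compact S" "convex S" "S \<noteq> {}" by (auto simp: S_def)
  moreover have "continuous_on S F"
    unfolding F_def using w \<rho>
    by (intro continuous_intros) (auto simp: complex_nonpos_Reals_iff dest: w(1))
  moreover have "F \<in> S \<rightarrow> S"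
  proof
    fix w assume "w \<in> S"
    note w = w[OF this]
    have "cmod (Ln w) \<le> \<bar>Re (Ln w)\<bar> + \<bar>Im (Ln w)\<bar>" by (rule cmod_le)
    also have "\<dots> \<le> ln \<rho> + pi / 2"
      using Re_Ln_pos_lt[OF w(2)] w by (intro add_mono) auto
    also have "\<dots> \<le> ln \<rho> + 2"
      using pi_less_4 by simp
    finally have "2 / \<rho> * cmod (Ln w) \<le> 2 / \<rho> * (ln \<rho> + 2)"
      using \<rho> by (intro mult_left_mono) auto
    also have "\<dots> \<le> 2 / 13 + 4 / 750"
    proof -
      have "2 / \<rho> * 2 \<le> 4 / 750" using \<rho> by (simp add: field_simps)
      then show ?thesis using small by (simp add: distrib_left)
    qed
    finally have 1: "2 / \<rho> * cmod (Ln w) \<le> 2 / 13 + 4 / 750" .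
    have 2: "1 / cmod w \<le> 1 / (11 / 2)"
      using w by (intro divide_left_mono) auto
    have "cmod (F w - \<alpha>) = cmod (\<i> / w - 2 * \<i> / of_real \<rho> * Ln w)"
      by (simp add: F_def)
    also have "\<dots> \<le> cmod (\<i> / w) + cmod (2 * \<i> / of_real \<rho> * Ln w)"
      by (rule norm_triangle_ineq4)
    also have "\<dots> = 1 / cmod w + 2 / \<rho> * cmod (Ln w)"
      using \<rho> by (simp add: norm_divide norm_mult)
    also have "\<dots> \<le> 1 / 2" using 1 2 by simp
    finally show "F w \<in> S"
      by (simp add: S_def dist_norm norm_minus_commute)
  qed
  ultimately obtain w where "w \<in> S" "F w = w"
    by (rule brouwer)
  with that[of w] show ?thesis
    by (simp add: S_def F_def dist_norm norm_minus_commute)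
qed

section \<open>From the fixed point to a mode\<close>

text \<open>With Euler's formulas, multiplying the conclusion by \<open>2 e\<close>, where
  \<open>e = exp (\<i> x)\<close>, turns it into
  \<open>\<kappa> (e^2 + 1) = k (e^2 - 1)\<close>.\<close>

lemma matching_from_exp:
  assumes "exp (2 * (\<i> * x)) * (\<kappa> - k) = - (\<kappa> + k)"
  shows "\<kappa> * cos x = \<i> * k * sin (x :: complex)"
proof -
  define e where "e = exp (\<i> * x)"
  have e: "e \<noteq> 0" "exp (- (\<i> * x)) = 1 / e" "exp (2 * (\<i> * x)) = e\<^sup>2"
    by (simp_all add: e_def exp_minus inverse_eq_divide exp_double)
  have "\<kappa> * (e\<^sup>2 + 1) = k * (e\<^sup>2 - 1)"
    using assms unfolding e(3) by (simp add: algebra_simps)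
  moreover have "e\<^sup>2 + 1 = e * (e + 1 / e)" "e\<^sup>2 - 1 = e * (e - 1 / e)"
    using e(1) by (simp_all add: distrib_left right_diff_distrib power2_eq_square)
  ultimately have "e * (\<kappa> * (e + 1 / e)) = e * (k * (e - 1 / e))"
    by (simp only: mult.left_commute)
  then have "\<kappa> * (e + 1 / e) = k * (e - 1 / e)"
    using e(1) by simp
  moreover have "k * d / 2 = \<i> * k * (d / (2 * \<i>))" for d
    by (simp add: field_simps)
  ultimately have "\<kappa> * ((e + 1 / e) / 2) = \<i> * k * ((e - 1 / e) / (2 * \<i>))"
    by (metis times_divide_eq_right)
  then show ?thesis
    unfolding sin_exp_eq cos_exp_eq e(2) by (simp add: e_def)
qed

text \<open>The condition on \<open>exp (\<i> \<rho> \<alpha>)\<close> says that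
  \<open>\<alpha>\<close> has the form \<open>(2 pi n - pi/2) / \<rho>\<close>. The bound on
  \<open>Re \<kappa>\<close> later separates modes with different \<open>n\<close>; the last two
  bounds control numerator and denominator of a summand of \<open>S_eps\<close>.\<close>

lemma mode_exists:
  fixes \<gamma> R \<alpha> :: real
  defines "\<rho> \<equiv> R * sqrt \<gamma>"
  assumes \<gamma>: "0 < \<gamma>" and \<rho>: "750 \<le> \<rho>"
    and \<alpha>: "6 \<le> \<alpha>" "(\<alpha> + 1 / 2) * ln \<rho> \<le> \<rho> / 2" "exp (\<i> * (\<rho> * \<alpha>)) = - \<i>"
  obtains \<kappa> k where "barrier_mode \<gamma> R \<kappa> k" "0 < Re \<kappa>"
    "\<bar>Re \<kappa> / sqrt \<gamma> - \<alpha> / 2\<bar> < pi / (2 * \<rho>)"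
    "\<gamma> / 2 \<le> Im (k\<^sup>2)" "cmod k \<le> sqrt \<gamma> * (\<alpha> + 1) / 2"
proof -
  obtain w :: complex where wd: "cmod (w - \<alpha>) \<le> 1 / 2" and w_eq: "w = \<alpha> + \<i> / w - 2 * \<i> / \<rho> * Ln w"
    using fixed_point_exists[OF \<rho> \<alpha>(1,2)] by blast
  have R: "0 < R"
    using \<rho> \<gamma> unfolding \<rho>_def by (smt (verit) mult_nonpos_nonneg real_sqrt_ge_zero)
  have Re_w: "\<alpha> - 1 / 2 \<le> Re w"
    using abs_Re_le_cmod[of "w - \<alpha>"] wd by simp
  then have norm_w: "11 / 2 \<le> cmod w" and w0: "w \<noteq> 0" and Re_pos: "0 < Re w"
    using \<alpha>(1) complex_Re_le_cmod[of w] by auto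
  have norm_w': "cmod w \<le> \<alpha> + 1 / 2"
    using norm_triangle_ineq[of "w - \<alpha>" "of_real \<alpha>"] \<alpha>(1) wd by simp
  have ln\<rho>: "1 \<le> ln \<rho>"
    using \<rho> exp_le by (subst ln_ge_iff) auto
  have "\<alpha> + 1 / 2 \<le> (\<alpha> + 1 / 2) * ln \<rho>"
    using mult_left_mono[OF ln\<rho>, of "\<alpha> + 1 / 2"] \<alpha>(1) by simp
  also have "\<dots> \<le> \<rho> / 2" by (rule \<alpha>)
  finally have "cmod w \<le> \<rho>"
    using \<rho> norm_w' by linarith
  moreover have "1 < cmod w" using norm_w by linarith
  ultimately have ln_w: "0 < ln (cmod w)" "ln (cmod w) \<le> ln \<rho>"
    using w0 \<rho> by auto
  define \<theta> where "\<theta> = Im (Ln w)"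
  have \<theta>: "\<bar>\<theta>\<bar> < pi / 2"
    using Re_Ln_pos_lt[OF w0] Re_pos by (simp add: \<theta>_def)
  define s where "s = sqrt \<gamma>"
  have s: "0 < s" "s\<^sup>2 = \<gamma>" "complex_of_real s * s = \<gamma>"
    using \<gamma> by (auto simp: s_def simp flip: of_real_mult)
  have s0: "complex_of_real s \<noteq> 0" using s by simp
  define \<kappa> where "\<kappa> = s * (w - \<i> / w) / 2"
  define k where "k = s * (w + \<i> / w) / 2"
  have "w - \<i> / w = \<alpha> - 2 * \<i> / \<rho> * Ln w"
    using w_eq by (simp add: algebra_simps)
  then have \<kappa>_eq: "\<kappa> = s * (\<alpha> - 2 * \<i> / \<rho> * Ln w) / 2"
    by (simp add: \<kappa>_def)
  have Re_\<kappa>: "Re \<kappa> = s * (\<alpha> / 2 + \<theta> / \<rho>)" and Im_\<kappa>: "Im \<kappa> = - s * ln (cmod w) / \<rho>"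
    unfolding \<kappa>_eq \<theta>_def using w0 \<rho> by (auto simp: field_simps Re_divide_of_real Im_divide_of_real)
  have \<theta>\<rho>: "\<bar>\<theta> / \<rho>\<bar> < pi / (2 * \<rho>)"
    using \<theta> \<rho> by (simp add: field_simps)
  have \<theta>\<rho>': "\<bar>\<theta> / \<rho>\<bar> < 1 / 4"
  proof -
    have "pi / (2 * \<rho>) < 4 / (2 * 8)" using \<rho> pi_less_4 by (intro frac_less) auto
    then show ?thesis using \<theta>\<rho> by linarith
  qed
  \<comment> \<open>The difference of the squares of \<open>w + \<i> / w\<close> and
    \<open>w - \<i> / w\<close> is \<open>4 \<i>\<close>, whatever \<open>w\<close> is.\<close>
  have disp: "k\<^sup>2 = \<kappa>\<^sup>2 + \<i> * \<gamma>"
    using w0 unfolding k_def \<kappa>_def s(3)[symmetric]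
    by (simp add: power2_eq_square field_simps)
  have "Im (k\<^sup>2) = \<gamma> + 2 * Re \<kappa> * Im \<kappa>"
    by (simp add: disp Im_power2)
  also have "2 * Re \<kappa> * Im \<kappa> = - \<gamma> * ((\<alpha> + 2 * (\<theta> / \<rho>)) * ln (cmod w) / \<rho>)"
  proof -
    have "2 * (s * (\<alpha> / 2 + t)) * (- s * l / \<rho>) = - s\<^sup>2 * ((\<alpha> + 2 * t) * l / \<rho>)" for t l
      by (simp add: algebra_simps power2_eq_square add_divide_distrib)
    then show ?thesis unfolding Re_\<kappa> Im_\<kappa> s(2)[symmetric] .
  qed
  finally have Im_k2: "Im (k\<^sup>2) = \<gamma> - \<gamma> * ((\<alpha> + 2 * (\<theta> / \<rho>)) * ln (cmod w) / \<rho>)" by simp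
  have t: "- 1 / 4 < \<theta> / \<rho>" "\<theta> / \<rho> < 1 / 4"
    using \<theta>\<rho>' by linarith+
  \<comment> \<open>The upper limit on \<open>\<alpha>\<close> enters here: it keeps the loss caused
    by the negative \<open>Im \<kappa>\<close> below half of \<open>\<gamma>\<close>.\<close>
  then have "\<alpha> + 2 * (\<theta> / \<rho>) \<le> \<alpha> + 1 / 2" by linarith
  then have "(\<alpha> + 2 * (\<theta> / \<rho>)) * ln (cmod w) \<le> (\<alpha> + 1 / 2) * ln \<rho>"
    using \<alpha>(1) ln_w by (intro mult_mono) auto
  also have "\<dots> \<le> \<rho> / 2" by (rule \<alpha>)
  finally have "(\<alpha> + 2 * (\<theta> / \<rho>)) * ln (cmod w) / \<rho> \<le> 1 / 2"
    using \<rho> by (simp add: field_simps)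
  from mult_left_mono[OF this, of \<gamma>] have Im_k2_ge: "\<gamma> / 2 \<le> Im (k\<^sup>2)"
    using \<gamma> unfolding Im_k2 by simp
  have iw: "cmod (\<i> / w) \<le> 1 / 2"
    using norm_w w0 by (simp add: norm_divide field_simps)
  have "0 < Re w + Re (\<i> / w)"
    using abs_Re_le_cmod[of "\<i> / w"] iw Re_w \<alpha>(1) by linarith
  then have Re_k: "0 < Re k"
    using s by (simp add: k_def)
  \<comment> \<open>\<open>Im (k^2) = 2 Re k Im k\<close> is positive, so \<open>Im k\<close>
    inherits the sign of \<open>Re k\<close>.\<close>
  have Im_k: "0 < Im k"
  proof -
    have "0 < Im (k\<^sup>2)" using Im_k2_ge \<gamma> by linarith
    then have "0 < 2 * Re k * Im k" by (simp only: Im_power2)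
    then show ?thesis using Re_k by (simp add: zero_less_mult_iff)
  qed
  have "cmod (w + \<i> / w) \<le> \<alpha> + 1"
    using norm_triangle_ineq[of w "\<i> / w"] iw norm_w' by linarith
  then have norm_k: "cmod k \<le> s * (\<alpha> + 1) / 2"
    using s by (simp add: k_def norm_mult norm_divide)
  \<comment> \<open>Exponentiating the logarithmic fixed point equation recovers the eigenvalue
    condition.\<close>
  have "2 * (\<i> * (\<kappa> * R)) = \<i> * (\<rho> * \<alpha>) + 2 * Ln w"
    using \<rho> s(1) R unfolding \<kappa>_eq \<rho>_def s_def[symmetric] by (simp add: field_simps)
  then have "exp (2 * (\<i> * (\<kappa> * R))) = - \<i> * w\<^sup>2"
    using \<alpha>(3) w0 by (simp add: exp_add exp_double)
  moreover have "\<kappa> - k = - s * \<i> / w" "\<kappa> + k = s * w"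
    by (simp_all add: \<kappa>_def k_def field_simps)
  moreover have "(- \<i> * w\<^sup>2) * (- s * \<i> / w) = - (s * w)"
    using w0 by (simp add: power2_eq_square mult_ac)
  ultimately have "exp (2 * (\<i> * (\<kappa> * R))) * (\<kappa> - k) = - (\<kappa> + k)"
    by metis
  then have match: "\<kappa> * cos (\<kappa> * R) = \<i> * k * sin (\<kappa> * R)"
    by (rule matching_from_exp)
  have "Im \<kappa> \<noteq> 0" using ln_w s \<rho> by (simp add: Im_\<kappa>)
  with \<gamma> R disp Im_k match have "barrier_mode \<gamma> R \<kappa> k"
    by unfold_locales
  moreover have "0 < Re \<kappa>"
    unfolding Re_\<kappa> using s(1) \<alpha>(1) t(1) by (intro mult_pos_pos) linarith+
  moreover have "\<bar>Re \<kappa> / sqrt \<gamma> - \<alpha> / 2\<bar> < pi / (2 * \<rho>)"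
    using s \<theta>\<rho> by (simp add: Re_\<kappa> flip: s_def)
  ultimately show ?thesis
    using that Im_k2_ge norm_k by (simp add: s_def)
qed

section \<open>Lower bounds for the eigenvalue sums\<close>

text \<open>Mean value theorem for \<open>t powr \<epsilon> / \<epsilon>\<close>, whose derivative
  decreases since \<open>\<epsilon> < 1\<close>. Together with \<open>ln_diff_le_of_add\<close>, the
  limiting case \<open>\<epsilon> = 0\<close>, it supplies the hypothesis \<open>step\<close> of
  \<open>sum_mode_range_ge\<close>.\<close>

lemma powr_diff_le:
  fixes x d \<epsilon> :: real
  assumes "0 < x" "0 < d" "0 < \<epsilon>" "\<epsilon> < 1"
  shows "(x + d) powr \<epsilon> / \<epsilon> - x powr \<epsilon> / \<epsilon> \<le> d * x powr (\<epsilon> - 1)"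
proof -
  obtain y where y: "x < y" "y < x + d"
    "(x + d) powr \<epsilon> / \<epsilon> - x powr \<epsilon> / \<epsilon> = (x + d - x) * y powr (\<epsilon> - 1)"
  proof (rule exE[OF MVT2[of x "x + d" "\<lambda>t. t powr \<epsilon> / \<epsilon>" "\<lambda>t. t powr (\<epsilon> - 1)"]])
    fix t assume "x \<le> t"
    then show "((\<lambda>t. t powr \<epsilon> / \<epsilon>) has_real_derivative t powr (\<epsilon> - 1)) (at t)"
      using assms by (auto intro!: derivative_eq_intros)
  qed (use assms in auto)
  have "y powr (\<epsilon> - 1) \<le> x powr (\<epsilon> - 1)"
    using y assms by (intro powr_mono2') auto
  then show ?thesis
    using y(3) assms by (simp add: mult_left_mono)
qed

lemma ln_diff_le_of_add:
  fixes x d :: real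
  assumes "0 < x" "0 < d"
  shows "ln (x + d) - ln x \<le> d * (1 / x)"
proof -
  have "ln (x + d) - ln x = ln ((x + d) / x)"
    using assms by (simp add: ln_div)
  also have "\<dots> = ln (1 + d / x)"
    using assms by (simp add: add_divide_distrib)
  also have "\<dots> \<le> d / x"
    using assms by (intro ln_add_one_self_le_self) auto
  finally show ?thesis by simp
qed

text \<open>These are values of \<open>\<alpha>\<close> with
  \<open>exp (\<i> \<rho> \<alpha>) = -\<i>\<close>. For \<open>h = \<rho> / (2 ln \<rho>)\<close>
  the indices in \<open>mode_range\<close> are those whose frequency meets the hypotheses of
  \<open>mode_exists\<close>.\<close>

definition mode_freq :: "real \<Rightarrow> nat \<Rightarrow> real" where
  "mode_freq \<rho> n = (2 * pi * n - pi / 2) / \<rho>"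

definition mode_range :: "real \<Rightarrow> real \<Rightarrow> nat set" where
  "mode_range \<rho> h = {n. 6 \<le> mode_freq \<rho> n \<and> mode_freq \<rho> n + 1 / 2 \<le> h}"

lemma mode_freq_Suc: "mode_freq \<rho> (Suc n) = mode_freq \<rho> n + 2 * pi / \<rho>"
  by (simp add: mode_freq_def add_divide_distrib diff_divide_distrib algebra_simps)

lemma mode_freq_mono: "0 < \<rho> \<Longrightarrow> m \<le> n \<Longrightarrow> mode_freq \<rho> m \<le> mode_freq \<rho> n"
  by (simp add: mode_freq_def divide_right_mono)

lemma mode_freq_unbounded:
  assumes "0 < \<rho>"
  shows "\<exists>n. c < mode_freq \<rho> n"
proof -
  obtain n where "(c * \<rho> + pi / 2) / (2 * pi) < real n"
    using reals_Archimedean2 by blast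
  then show ?thesis
    using assms by (intro exI[of _ n]) (simp add: mode_freq_def field_simps)
qed

lemma finite_mode_range:
  assumes "0 < \<rho>"
  shows "finite (mode_range \<rho> h)"
proof -
  obtain N where N: "h < mode_freq \<rho> N"
    using mode_freq_unbounded[OF assms] by blast
  have "mode_range \<rho> h \<subseteq> {..N}"
  proof
    fix n assume "n \<in> mode_range \<rho> h"
    then have "mode_freq \<rho> n < mode_freq \<rho> N" using N by (auto simp: mode_range_def)
    then show "n \<in> {..N}"
      using mode_freq_mono[OF assms, of N n] by (meson atMost_iff linorder_not_le nat_le_linear)
  qed
  then show ?thesis by (rule finite_subset) simp
qed

text \<open>Consecutive frequencies differ by \<open>2 pi / \<rho>\<close>, so the increments of
  \<open>G\<close> telescope and each is at most that spacing times \<open>g\<close>. The lower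
  limit 15/2 is 6 + 1/2 + 1: the first admissible frequency overshoots 6 by at most 1/2, and
  \<open>g\<close> is evaluated one unit further.\<close>

lemma sum_mode_range_ge:
  fixes g G :: "real \<Rightarrow> real"
  assumes \<rho>: "750 \<le> \<rho>" and h: "7 \<le> h"
    and mono: "\<And>x y. 0 < x \<Longrightarrow> x \<le> y \<Longrightarrow> G x \<le> G y"
    and step: "\<And>x d. 0 < x \<Longrightarrow> 0 < d \<Longrightarrow> G (x + d) - G x \<le> d * g x"
    and nonneg: "\<And>x. 0 < x \<Longrightarrow> 0 \<le> g x"
  shows "\<rho> / (2 * pi) * (G h - G (15 / 2)) \<le> (\<Sum>n\<in>mode_range \<rho> h. g (mode_freq \<rho> n + 1))"
proof -
  let ?a = "mode_freq \<rho>" and ?d = "2 * pi / \<rho>"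
  have d: "0 < ?d" "?d \<le> 1 / 2"
  proof -
    show "0 < ?d" using \<rho> by simp
    have "2 * pi \<le> 1 / 2 * \<rho>" using \<rho> pi_less_4 by simp
    then show "?d \<le> 1 / 2" using \<rho> by (simp add: field_simps)
  qed
  define N where "N = (LEAST n. 6 \<le> ?a n)"
  \<comment> \<open>\<open>M\<close> is the first index beyond the range, so that
    \<open>?a M + 1\<close> lies above \<open>h\<close> and the telescoped sum reaches at least
    \<open>G h\<close>.\<close>
  define M where "M = (LEAST n. h < ?a n + 1 / 2)"
  have "0 < \<rho>" using \<rho> by simp
  obtain n m where "6 < ?a n" "h < ?a m"
    using mode_freq_unbounded[OF \<open>0 < \<rho>\<close>] by meson
  then have nm: "6 \<le> ?a n" "h < ?a m + 1 / 2" by linarith+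
  have N: "6 \<le> ?a N"
    unfolding N_def using nm(1) by (rule LeastI)
  have M: "h < ?a M + 1 / 2"
    unfolding M_def using nm(2) by (rule LeastI)
  have a0: "?a 0 < 0" using \<rho> by (simp add: mode_freq_def field_simps)
  have N': "?a N \<le> 6 + 1 / 2"
  proof (cases N)
    case 0
    then show ?thesis using a0 N by simp
  next
    case (Suc n)
    then have "\<not> 6 \<le> ?a n" unfolding N_def by (metis lessI not_less_Least)
    then show ?thesis using d Suc by (simp add: mode_freq_Suc)
  qed
  have "N \<le> M"
  proof (rule ccontr)
    assume "\<not> N \<le> M"
    then have "\<not> 6 \<le> ?a M" unfolding N_def by (metis not_le not_less_Least)
    with M h show False by simp
  qed
  have sub: "{N..<M} \<subseteq> mode_range \<rho> h"
  proof
    fix n assume n: "n \<in> {N..<M}"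
    then have "?a N \<le> ?a n" using \<rho> by (intro mode_freq_mono) auto
    moreover have "\<not> h < ?a n + 1 / 2"
      using n not_less_Least[of n "\<lambda>n. h < ?a n + 1 / 2"] by (simp add: M_def)
    ultimately show "n \<in> mode_range \<rho> h" using N by (simp add: mode_range_def)
  qed
  have "G h - G (15 / 2) \<le> G (?a M + 1) - G (?a N + 1)"
    using mono[of h "?a M + 1"] mono[of "?a N + 1" "15 / 2"] M h N N' by linarith
  also have "\<dots> = (\<Sum>n\<in>{N..<M}. G (?a (Suc n) + 1) - G (?a n + 1))"
    using sum_Suc_diff'[OF \<open>N \<le> M\<close>, of "\<lambda>n. G (?a n + 1)"] by simp
  also have "\<dots> \<le> (\<Sum>n\<in>{N..<M}. ?d * g (?a n + 1))"
  proof (rule sum_mono)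
    fix n assume "n \<in> {N..<M}"
    then have "6 \<le> ?a n" using sub by (auto simp: mode_range_def)
    then show "G (?a (Suc n) + 1) - G (?a n + 1) \<le> ?d * g (?a n + 1)"
      using step[of "?a n + 1" ?d] d by (simp add: mode_freq_Suc algebra_simps)
  qed
  also have "\<dots> = ?d * (\<Sum>n\<in>{N..<M}. g (?a n + 1))"
    by (simp add: sum_distrib_left)
  also have "\<dots> \<le> ?d * (\<Sum>n\<in>mode_range \<rho> h. g (?a n + 1))"
  proof (intro mult_left_mono sum_mono2)
    show "finite (mode_range \<rho> h)" using \<rho> by (intro finite_mode_range) auto
    show "0 \<le> g (?a n + 1)" if "n \<in> mode_range \<rho> h - {N..<M}" for n
      using that by (intro nonneg) (auto simp: mode_range_def)
  qed (use sub d in auto)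
  finally have "G h - G (15 / 2) \<le> ?d * (\<Sum>n\<in>mode_range \<rho> h. g (?a n + 1))" .
  from mult_left_mono[OF this, of "\<rho> / (2 * pi)"] show ?thesis
    using \<rho> by simp
qed

section \<open>Reduction of the eigenvalue sum to a sum over frequencies\<close>

text \<open>Every index yields its own simple eigenvalue \<open>k^2\<close>. Its distance to the
  half line is at least \<open>\<gamma> / 2\<close>, and the denominator equals
  \<open>cmod k powr (1 - \<epsilon>)\<close>, which \<open>mode_exists\<close> bounds from
  above.\<close>

lemma S_eps_ge_sum:
  fixes \<gamma> R \<epsilon> :: real
  defines "\<rho> \<equiv> R * sqrt \<gamma>"
  assumes \<gamma>: "0 < \<gamma>" and \<rho>: "750 \<le> \<rho>" and \<epsilon>: "\<epsilon> < 1"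
  shows "ennreal (\<Sum>n\<in>mode_range \<rho> (\<rho> / (2 * ln \<rho>)).
      (\<gamma> / 2) * (sqrt \<gamma> / 2) powr (\<epsilon> - 1) * (mode_freq \<rho> n + 1) powr (\<epsilon> - 1)) \<le> S_eps \<epsilon> \<gamma> R"
proof -
  let ?I = "mode_range \<rho> (\<rho> / (2 * ln \<rho>))" and ?a = "mode_freq \<rho>"
  let ?A = "complex_of_real ` {0..}"
  define P where "P n \<kappa> k \<longleftrightarrow> barrier_mode \<gamma> R \<kappa> k \<and> 0 < Re \<kappa>
    \<and> \<bar>Re \<kappa> / sqrt \<gamma> - ?a n / 2\<bar> < pi / (2 * \<rho>)
    \<and> \<gamma> / 2 \<le> Im (k\<^sup>2) \<and> cmod k \<le> sqrt \<gamma> * (?a n + 1) / 2" for n \<kappa> k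
  have "\<exists>\<kappa> k. P n \<kappa> k" if "n \<in> ?I" for n
  proof -
    have "0 < ln \<rho>" using \<rho> by simp
    then have a: "6 \<le> ?a n" "(?a n + 1 / 2) * ln \<rho> \<le> \<rho> / 2"
      using that by (auto simp: mode_range_def field_simps)
    have "\<rho> * ?a n = 2 * real n * pi - pi / 2"
      using \<rho> by (simp add: mode_freq_def)
    then have "exp (\<i> * complex_of_real (\<rho> * ?a n)) = cis (2 * real n * pi - pi / 2)"
      by (simp only: cis_conv_exp)
    also have "\<dots> = - \<i>"
      by (simp add: complex_eq_iff cos_diff sin_diff)
    finally have "exp (\<i> * (\<rho> * ?a n)) = - \<i>" by simp
    from mode_exists[OF \<gamma> \<rho>[unfolded \<rho>_def] a[unfolded \<rho>_def] this[unfolded \<rho>_def]]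
    show ?thesis unfolding P_def \<rho>_def by blast
  qed
  then obtain \<kappa> k where P: "\<And>n. n \<in> ?I \<Longrightarrow> P n (\<kappa> n) (k n)" by metis
  \<comment> \<open>Equal \<open>k^2\<close> give equal \<open>\<kappa>^2\<close>, and positive real
    parts exclude opposite signs. Then \<open>Re \<kappa> / sqrt \<gamma>\<close> is within
    \<open>pi / (2 \<rho>)\<close> of both half frequencies, whereas different frequencies are at
    least \<open>2 pi / \<rho>\<close> apart.\<close>
  have inj: "inj_on (\<lambda>n. (k n)\<^sup>2) ?I"
  proof (rule inj_onI)
    fix m n assume mn: "m \<in> ?I" "n \<in> ?I" and eq: "(k m)\<^sup>2 = (k n)\<^sup>2"
    note Pm = P[OF mn(1), unfolded P_def] and Pn = P[OF mn(2), unfolded P_def]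
    have "(\<kappa> m)\<^sup>2 = (\<kappa> n)\<^sup>2"
      using barrier_mode.dispersion Pm Pn eq by (metis add_right_cancel)
    then have "\<kappa> m = \<kappa> n \<or> \<kappa> m = - \<kappa> n" by (simp add: power2_eq_iff)
    then have "\<kappa> m = \<kappa> n" using Pm Pn by auto
    then have "\<bar>?a m - ?a n\<bar> < 2 * pi / \<rho>"
      using Pm Pn by (simp add: abs_less_iff)
    moreover have "?a m - ?a n = 2 * pi / \<rho> * (real m - real n)"
      by (simp add: mode_freq_def diff_divide_distrib algebra_simps)
    ultimately have "2 * pi / \<rho> * \<bar>real m - real n\<bar> < 2 * pi / \<rho> * 1"
      using \<rho> by (simp add: abs_mult)
    then have "\<bar>real m - real n\<bar> < 1"
      using \<rho> by (subst (asm) mult_less_cancel_left_pos) auto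
    then show "m = n" by linarith
  qed
  have infdist: "\<gamma> / 2 \<le> infdist ((k n)\<^sup>2) ?A" if "n \<in> ?I" for n
  proof -
    have ne: "?A \<noteq> {}" by auto
    show ?thesis
      unfolding infdist_notempty[OF ne]
    proof (rule cINF_greatest[OF ne])
      fix x assume "x \<in> ?A"
      then have "Im ((k n)\<^sup>2) \<le> dist ((k n)\<^sup>2) x"
        using abs_Im_le_cmod[of "(k n)\<^sup>2 - x"] by (auto simp: dist_norm)
      then show "\<gamma> / 2 \<le> dist ((k n)\<^sup>2) x"
        using P[OF that] by (simp add: P_def)
    qed
  qed
  have mem: "(k n)\<^sup>2 \<in> sigma_d \<gamma> R" if "n \<in> ?I" for n
  proof -
    have "(k n)\<^sup>2 \<notin> ?A"
      using infdist[OF that] \<gamma> infdist_zero[of "(k n)\<^sup>2" ?A] by linarith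
    moreover have "barrier_mode \<gamma> R (\<kappa> n) (k n)" using P[OF that] by (simp add: P_def)
    ultimately show ?thesis
      by (simp add: sigma_d_def barrier_mode.is_eigenvalue barrier_mode.finite_alg_mult)
  qed
  let ?f = "\<lambda>z. of_nat (alg_mult \<gamma> R z) * ennreal (infdist z ?A / cmod z powr ((1 - \<epsilon>) / 2))"
  have term_le: "ennreal ((\<gamma> / 2) * (sqrt \<gamma> / 2) powr (\<epsilon> - 1) * (?a n + 1) powr (\<epsilon> - 1)) \<le> ?f ((k n)\<^sup>2)"
    if "n \<in> ?I" for n
  proof -
    have mode: "barrier_mode \<gamma> R (\<kappa> n) (k n)" and kn: "cmod (k n) \<le> sqrt \<gamma> / 2 * (?a n + 1)"
      using P[OF that] by (simp_all add: P_def)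
    have a: "6 \<le> ?a n" using that by (simp add: mode_range_def)
    have k0: "0 < cmod (k n)" using barrier_mode.nonzero[OF mode] by simp
    have "(sqrt \<gamma> / 2) powr (\<epsilon> - 1) * (?a n + 1) powr (\<epsilon> - 1) = (sqrt \<gamma> / 2 * (?a n + 1)) powr (\<epsilon> - 1)"
      using \<gamma> a by (intro powr_mult[symmetric])
    also have "\<dots> \<le> cmod (k n) powr (\<epsilon> - 1)"
      using k0 kn \<epsilon> by (intro powr_mono2') auto
    also have "\<dots> = inverse (cmod ((k n)\<^sup>2) powr ((1 - \<epsilon>) / 2))"
    proof -
      have "cmod ((k n)\<^sup>2) = cmod (k n) powr 2" using k0 by (simp add: norm_power)
      then have "cmod ((k n)\<^sup>2) powr ((1 - \<epsilon>) / 2) = cmod (k n) powr (1 - \<epsilon>)"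
        by (simp only: powr_powr) (simp add: diff_divide_distrib)
      then show ?thesis by (simp add: powr_minus[symmetric])
    qed
    finally have le: "(sqrt \<gamma> / 2) powr (\<epsilon> - 1) * (?a n + 1) powr (\<epsilon> - 1)
        \<le> inverse (cmod ((k n)\<^sup>2) powr ((1 - \<epsilon>) / 2))" .
    have "(\<gamma> / 2) * ((sqrt \<gamma> / 2) powr (\<epsilon> - 1) * (?a n + 1) powr (\<epsilon> - 1))
        \<le> infdist ((k n)\<^sup>2) ?A * inverse (cmod ((k n)\<^sup>2) powr ((1 - \<epsilon>) / 2))"
      by (rule mult_mono[OF infdist[OF that] le]) (simp_all add: infdist_nonneg)
    then have "ennreal ((\<gamma> / 2) * (sqrt \<gamma> / 2) powr (\<epsilon> - 1) * (?a n + 1) powr (\<epsilon> - 1))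
        \<le> ennreal (infdist ((k n)\<^sup>2) ?A / cmod ((k n)\<^sup>2) powr ((1 - \<epsilon>) / 2))"
      unfolding divide_inverse[of "infdist _ _"] mult.assoc by (rule ennreal_leI)
    then show ?thesis
      unfolding barrier_mode.alg_mult[OF mode] by simp
  qed
  have "ennreal (\<Sum>n\<in>?I. (\<gamma> / 2) * (sqrt \<gamma> / 2) powr (\<epsilon> - 1) * (?a n + 1) powr (\<epsilon> - 1))
      = (\<Sum>n\<in>?I. ennreal ((\<gamma> / 2) * (sqrt \<gamma> / 2) powr (\<epsilon> - 1) * (?a n + 1) powr (\<epsilon> - 1)))"
    using \<gamma> by (intro sum_ennreal[symmetric]) auto
  also have "\<dots> \<le> (\<Sum>n\<in>?I. ?f ((k n)\<^sup>2))"
    by (rule sum_mono) (rule term_le)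
  also have "\<dots> = sum ?f ((\<lambda>n. (k n)\<^sup>2) ` ?I)"
    using inj by (simp add: sum.reindex)
  also have "\<dots> = infsum ?f ((\<lambda>n. (k n)\<^sup>2) ` ?I)"
    using \<rho> by (intro infsum_finite[symmetric] finite_imageI finite_mode_range) auto
  also have "\<dots> \<le> infsum ?f (sigma_d \<gamma> R)"
    using mem by (intro infsum_mono_neutral nonneg_summable_on_complete) auto
  finally show ?thesis by (simp add: S_eps_def)
qed

section \<open>Size of \<open>\<rho>\<close> and of the range of frequencies\<close>

text \<open>With \<open>t = \<gamma> powr (3/4)\<close> one has \<open>\<rho>^3 = R (R t)^2\<close>.
  The hypothesis gives \<open>600 t \<le> R\<close> and \<open>600 \<le> R t\<close>, hence the two
  cubic bounds, and \<open>t + 1/t \<ge> 2\<close> gives \<open>1200 \<le> R\<close>.\<close>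

lemma radius_bounds:
  fixes \<gamma> R :: real
  defines "\<rho> \<equiv> R * sqrt \<gamma>"
  assumes \<gamma>: "0 < \<gamma>" and R: "R \<ge> 600 * (\<gamma> powr (3/4) + \<gamma> powr (-3/4))"
  shows "1200 \<le> R" "750 \<le> \<rho>" "360000 * R \<le> \<rho> ^ 3" "\<rho> ^ 3 \<le> R ^ 5"
proof -
  define t where "t = \<gamma> powr (3/4)"
  have t: "0 < t" "\<gamma> powr (-3/4) = 1 / t"
    using \<gamma> by (simp_all add: t_def powr_minus inverse_eq_divide)
  have t2: "t\<^sup>2 = sqrt \<gamma> ^ 3"
  proof -
    have "t\<^sup>2 = \<gamma> powr (3/2)"
      by (simp add: t_def power2_eq_square flip: powr_add)
    also have "\<dots> = (\<gamma> powr (1/2)) powr 3" by (simp add: powr_powr)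
    also have "\<dots> = sqrt \<gamma> ^ 3" using \<gamma> by (simp add: powr_half_sqrt)
    finally show ?thesis .
  qed
  define v where "v = 1 / t"
  have v: "0 < v" using t by (simp add: v_def)
  have R': "600 * (t + v) \<le> R" using R t by (simp add: t_def v_def)
  have Rt1: "600 * t \<le> R"
    using R' v by argo
  have "600 * v \<le> R"
    using R' t(1) by argo
  then have Rt2: "600 \<le> R * t"
    using t by (simp add: v_def field_simps)
  have "2 \<le> t + v"
    using t sum_squares_bound[of t 1] by (simp add: v_def field_simps power2_eq_square)
  then show R1200: "1200 \<le> R" using R' by argo
  have "\<rho> ^ 3 = R ^ 3 * t\<^sup>2"
    by (simp only: \<rho>_def power_mult_distrib t2)
  then have \<rho>3: "\<rho> ^ 3 = R * (R * t)\<^sup>2"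
    by (simp add: power2_eq_square power3_eq_cube)
  have "600\<^sup>2 \<le> (R * t)\<^sup>2"
    using Rt2 by (intro power_mono) auto
  then have "600\<^sup>2 * R \<le> (R * t)\<^sup>2 * R"
    using R1200 by (intro mult_right_mono) auto
  then show 360000: "360000 * R \<le> \<rho> ^ 3"
    by (simp add: \<rho>3 mult.commute)
  show "750 \<le> \<rho>"
  proof (rule ccontr)
    assume "\<not> 750 \<le> \<rho>"
    moreover have "0 \<le> \<rho>" using R1200 \<gamma> by (simp add: \<rho>_def)
    ultimately have "\<rho> ^ 3 \<le> 750 ^ 3" by (intro power_mono) auto
    \<comment> \<open>The cube of 750 is 421875000, less than
      \<open>360000 * 1200 = 432000000\<close>.\<close>
    with 360000 R1200 show False by simp
  qed
  have "R * t \<le> R * R"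
    using Rt1 R1200 t by (intro mult_left_mono) auto
  then have "(R * t)\<^sup>2 \<le> (R * R)\<^sup>2"
    using R1200 t by (intro power_mono) auto
  then have "R * (R * t)\<^sup>2 \<le> R * (R * R)\<^sup>2"
    using R1200 by (intro mult_left_mono) auto
  also have "\<dots> = R ^ 5" by (simp add: power2_eq_square eval_nat_numeral)
  finally show "\<rho> ^ 3 \<le> R ^ 5" by (simp add: \<rho>3)
qed

lemma range_end_ge_7:
  fixes \<rho> :: real
  assumes "750 \<le> \<rho>"
  shows "7 \<le> \<rho> / (2 * ln \<rho>)"
proof -
  define y where "y = sqrt \<rho>"
  have y: "27 \<le> y" "\<rho> = y\<^sup>2"
    using assms by (auto simp: y_def intro: real_le_rsqrt)
  have "ln \<rho> = 2 * ln y"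
    using y by (simp add: ln_realpow)
  also have "\<dots> \<le> 2 * (y - 1)"
    using ln_le_minus_one[of y] y by simp
  finally have "14 * ln \<rho> \<le> 28 * y - 28" by simp
  also have "\<dots> \<le> \<rho>"
    \<comment> \<open>The product \<open>(y - 27) (y - 1)\<close> is
      \<open>y^2 - 28 y + 27\<close>.\<close>
    using mult_nonneg_nonneg[of "y - 27" "y - 1"] y by (simp add: power2_eq_square algebra_simps)
  finally have "7 * (2 * ln \<rho>) \<le> \<rho>" by simp
  moreover have "0 < ln \<rho>" using assms by simp
  ultimately show ?thesis by (simp add: pos_le_divide_eq)
qed

text \<open>In terms of \<open>L = ln \<rho>\<close> the left side is at most
  \<open>3 L / 8 - 3/2\<close>. The tangent of \<open>ln\<close> at 1, used for
  \<open>L / 6\<close>, bounds the right side below by \<open>5 L / 6 - 4\<close>. The inequality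
  follows from \<open>L \<ge> 6\<close>.\<close>

lemma log_range_ge:
  fixes \<rho> R :: real
  assumes \<rho>: "750 \<le> \<rho>" and R: "1200 \<le> R" "360000 * R \<le> \<rho> ^ 3"
  shows "ln R / 8 \<le> ln (\<rho> / (2 * ln \<rho>)) - ln (15 / 2)"
proof -
  define L where "L = ln \<rho>"
  have e: "exp 1 < (272 / 100 :: real)" by (rule e_less_272)
  have exp_le: "exp (real n) \<le> (272 / 100) ^ n" for n
    using power_mono[of "exp 1" "272 / 100 :: real" n] e by (simp add: exp_of_nat_mult[of n 1, simplified])
  have L: "6 \<le> L"
    unfolding L_def using exp_le[of 6] \<rho> by (subst ln_ge_iff) (simp_all add: eval_nat_numeral)
  have "ln 360000 + ln R = ln (360000 * R)"
    using R by (simp add: ln_mult)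
  also have "\<dots> \<le> ln (\<rho> ^ 3)"
    using R \<rho> by (subst ln_le_cancel_iff) auto
  also have "\<dots> = 3 * L"
    using \<rho> by (simp add: L_def ln_realpow)
  finally have lnR: "ln R \<le> 3 * L - ln 360000" by simp
  have big: "12 \<le> ln (360000 :: real)"
    using exp_le[of 12] by (subst ln_ge_iff) (simp_all add: eval_nat_numeral)
  have ln90: "ln (90 :: real) \<le> 5"
  proof -
    have "(5 / 2 :: real) ^ 5 \<le> exp 1 ^ 5"
      using exp_lower_Taylor_quadratic[of 1] by (intro power_mono) auto
    then have "(90 :: real) \<le> exp 5"
      by (simp add: eval_nat_numeral flip: exp_of_nat_mult exp_add)
    then have "ln 90 \<le> ln (exp (5 :: real))" by (subst ln_le_cancel_iff) auto
    then show ?thesis by simp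
  qed
  have "ln (\<rho> / (2 * ln \<rho>)) - ln (15 / 2) = L - (ln (2 * L) + ln (15 / 2))"
    using \<rho> L by (simp add: ln_div L_def)
  also have "ln (2 * L) + ln (15 / 2) = ln (90 * (L / 6))"
    using L by (simp flip: ln_mult_pos)
  also have "\<dots> = ln 90 + ln (L / 6)"
    using L by (subst ln_mult) auto
  finally have "ln (\<rho> / (2 * ln \<rho>)) - ln (15 / 2) = L - (ln 90 + ln (L / 6))" .
  moreover have "ln (L / 6) \<le> L / 6 - 1"
    using L by (intro ln_le_minus_one) auto
  ultimately show ?thesis
    using lnR big ln90 L by simp
qed

section \<open>The logarithmic bound\<close>

lemma S_0_ge:
  fixes \<gamma> R :: real
  assumes \<gamma>: "0 < \<gamma>" and R: "R \<ge> 600 * (\<gamma> powr (3/4) + \<gamma> powr (-3/4))"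
  shows "ennreal (\<gamma> * R / (16 * pi) * ln R) \<le> S_eps 0 \<gamma> R"
proof -
  define \<rho> where "\<rho> = R * sqrt \<gamma>"
  note b = radius_bounds[OF \<gamma> R, folded \<rho>_def]
  let ?h = "\<rho> / (2 * ln \<rho>)"
  have "\<rho> / (2 * pi) * (ln R / 8) \<le> \<rho> / (2 * pi) * (ln ?h - ln (15 / 2))"
    using log_range_ge[OF b(2,1,3)] b(2) by (intro mult_left_mono) auto
  also have "\<dots> \<le> (\<Sum>n\<in>mode_range \<rho> ?h. 1 / (mode_freq \<rho> n + 1))"
    using b(2) range_end_ge_7[OF b(2)] ln_diff_le_of_add
    by (intro sum_mode_range_ge) auto
  finally have "\<rho> / (2 * pi) * (ln R / 8) \<le> (\<Sum>n\<in>mode_range \<rho> ?h. 1 / (mode_freq \<rho> n + 1))" .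
  from mult_left_mono[OF this, of "sqrt \<gamma>"]
  have "\<gamma> * R / (16 * pi) * ln R \<le> sqrt \<gamma> * (\<Sum>n\<in>mode_range \<rho> ?h. 1 / (mode_freq \<rho> n + 1))"
    using \<gamma> by (simp add: \<rho>_def mult_ac flip: mult.assoc[of "sqrt \<gamma>" "sqrt \<gamma>"])
  also have "\<dots> = (\<Sum>n\<in>mode_range \<rho> ?h. (\<gamma> / 2) * (sqrt \<gamma> / 2) powr (0 - 1) * (mode_freq \<rho> n + 1) powr (0 - 1))"
  proof -
    \<comment> \<open>For \<open>\<epsilon> = 0\<close> the prefactor collapses to
      \<open>sqrt \<gamma>\<close>, and \<open>sqrt \<gamma> * \<rho> = \<gamma> R\<close>.\<close>
    have "(\<gamma> / 2) * (sqrt \<gamma> / 2) powr (0 - 1) = sqrt \<gamma>"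
      using \<gamma> by (simp add: powr_neg_one real_div_sqrt)
    moreover have "(mode_freq \<rho> n + 1) powr (0 - 1) = 1 / (mode_freq \<rho> n + 1)" if "n \<in> mode_range \<rho> ?h" for n
      using that by (simp add: mode_range_def powr_neg_one)
    ultimately show ?thesis
      by (simp add: sum_distrib_left)
  qed
  finally show ?thesis
    using S_eps_ge_sum[of \<gamma> R 0] \<gamma> b(2) by (auto simp: \<rho>_def intro: order_trans ennreal_leI)
qed

section \<open>The power bound for positive \<open>\<epsilon>\<close>\<close>

text \<open>This is \<open>ln y \<le> y / e\<close> at \<open>y = sqrt x\<close>; it accounts for
  the factor \<open>4 / exp 2\<close> in the largeness condition on \<open>R\<close>.\<close>

lemma ln_le_sqrt:
  fixes x :: real
  assumes "0 < x"
  shows "ln x \<le> 2 / exp 1 * sqrt x"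
proof -
  have "ln (sqrt x / exp 1) \<le> sqrt x / exp 1 - 1"
    using assms by (intro ln_le_minus_one) auto
  then show ?thesis
    using assms by (simp add: ln_div ln_sqrt mult.commute)
qed

lemma ln_radius_le:
  fixes \<rho> R :: real
  assumes "0 < \<rho>" "0 < R" "\<rho> ^ 3 \<le> R ^ 5"
  shows "ln \<rho> \<le> 5 / 3 * ln R"
proof -
  have "ln (\<rho> ^ 3) \<le> ln (R ^ 5)"
    using assms by (subst ln_le_cancel_iff) auto
  then show ?thesis using assms by (simp add: ln_realpow)
qed

text \<open>It makes the contribution of the lower limit 15/2 at most half of that of the upper
  limit. With \<open>c = (64 pi) powr (1 / \<epsilon>)\<close>, the largeness of \<open>R\<close>
  and \<open>ln_le_sqrt\<close> give \<open>c ln R \<le> \<rho>\<close>, so the upper limit is at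
  least \<open>3 c / 10\<close>.\<close>

lemma range_powr_ge_2:
  fixes \<gamma> R \<epsilon> :: real
  defines "\<rho> \<equiv> R * sqrt \<gamma>"
  assumes \<gamma>: "0 < \<gamma>" and R: "1200 \<le> R" and \<rho>: "750 \<le> \<rho>" "\<rho> ^ 3 \<le> R ^ 5" and \<epsilon>: "0 < \<epsilon>" "\<epsilon> < 1"
    and large: "4 / (exp 2 * \<gamma>) * (64 * pi) powr (2 / \<epsilon>) + 1 \<le> R"
  shows "2 * (15 / 2) powr \<epsilon> \<le> (\<rho> / (2 * ln \<rho>)) powr \<epsilon>"
proof -
  define c where "c = (64 * pi) powr (1 / \<epsilon>)"
  have c: "0 < c" "c powr \<epsilon> = 64 * pi" "(64 * pi) powr (2 / \<epsilon>) = c\<^sup>2"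
    using \<epsilon> by (auto simp: c_def powr_powr power2_eq_square simp flip: powr_add)
  have ln\<rho>: "0 < ln \<rho>" using \<rho> by simp
  have lnR: "ln \<rho> \<le> 5 / 3 * ln R"
    using \<rho> R by (intro ln_radius_le) auto
  have "4 / (exp 2 * \<gamma>) * c\<^sup>2 \<le> R" using large c by simp
  then have "(2 / exp 1 * c)\<^sup>2 \<le> \<gamma> * R"
    using \<gamma> by (simp add: field_simps power2_eq_square flip: exp_add)
  then have "(2 / exp 1 * c)\<^sup>2 * R \<le> \<gamma> * R * R"
    using R by (intro mult_right_mono) auto
  also have "\<dots> = \<rho>\<^sup>2"
    using \<gamma> by (simp add: \<rho>_def power2_eq_square)
  finally have "(2 / exp 1 * c * sqrt R)\<^sup>2 \<le> \<rho>\<^sup>2"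
    using R by (simp add: power_mult_distrib power_divide)
  then have "2 / exp 1 * c * sqrt R \<le> \<rho>"
    by (rule power2_le_imp_le) (use \<rho> in simp)
  moreover have "c * ln R \<le> c * (2 / exp 1 * sqrt R)"
    using c R by (intro mult_left_mono ln_le_sqrt) auto
  ultimately have "c * ln R \<le> \<rho>" by (simp add: mult_ac)
  moreover have "c * ln \<rho> \<le> c * (5 / 3 * ln R)"
    using c lnR by (intro mult_left_mono) auto
  ultimately have "c * ln \<rho> \<le> 5 / 3 * \<rho>" by (simp add: algebra_simps)
  then have ge: "c / 25 * (15 / 2) \<le> \<rho> / (2 * ln \<rho>)"
    using ln\<rho> by (simp add: field_simps)
  \<comment> \<open>As \<open>25 powr \<epsilon> \<le> 25\<close>, the number
    \<open>(c / 25) powr \<epsilon>\<close> is at least \<open>64 pi / 25\<close>.\<close>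
  have "2 * 25 \<le> 64 * pi" using pi_ge_two by simp
  moreover have "25 powr \<epsilon> \<le> 25 powr 1" using \<epsilon> by (intro powr_mono) auto
  ultimately have "2 \<le> (c / 25) powr \<epsilon>"
    using c by (simp add: powr_divide field_simps)
  then have "2 * (15 / 2) powr \<epsilon> \<le> (c / 25) powr \<epsilon> * (15 / 2) powr \<epsilon>"
    by (intro mult_right_mono) auto
  also have "\<dots> = (c / 25 * (15 / 2)) powr \<epsilon>"
    using c by (intro powr_mult[symmetric])
  also have "\<dots> \<le> (\<rho> / (2 * ln \<rho>)) powr \<epsilon>"
    using ge c \<epsilon> by (intro powr_mono2) auto
  finally show ?thesis .
qed

lemma S_eps_ge:
  fixes \<gamma> R \<epsilon> :: real
  assumes \<gamma>: "0 < \<gamma>" and R: "R \<ge> 600 * (\<gamma> powr (3/4) + \<gamma> powr (-3/4))"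
    and \<epsilon>: "0 < \<epsilon>" "\<epsilon> < 1" and large: "R \<ge> 4 / (exp 2 * \<gamma>) * (64 * pi) powr (2 / \<epsilon>) + 1"
  shows "ennreal (1 / (256 * pi * \<epsilon>) * (\<gamma> * R) powr (1 + \<epsilon>) / (ln R) powr \<epsilon>) \<le> S_eps \<epsilon> \<gamma> R"
proof -
  define \<rho> where "\<rho> = R * sqrt \<gamma>"
  note b = radius_bounds[OF \<gamma> R, folded \<rho>_def]
  define h where "h = \<rho> / (2 * ln \<rho>)"
  define s where "s = sqrt \<gamma> / 2"
  have s: "0 < s" "\<gamma> = 4 * s * s" using \<gamma> by (auto simp: s_def)
  have h: "7 \<le> h" using range_end_ge_7[OF b(2)] by (simp add: h_def)
  have ln: "0 < ln \<rho>" "0 < ln R" "ln \<rho> \<le> 5 / 3 * ln R"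
    using b ln_radius_le[of \<rho> R] by auto
  have "\<rho> / (2 * pi) * (h powr \<epsilon> / (2 * \<epsilon>)) \<le> \<rho> / (2 * pi) * (h powr \<epsilon> / \<epsilon> - (15 / 2) powr \<epsilon> / \<epsilon>)"
    using range_powr_ge_2[OF \<gamma> b(1) b(2)[unfolded \<rho>_def] b(4)[unfolded \<rho>_def] \<epsilon> large, folded \<rho>_def, folded h_def] b(2) \<epsilon>
    by (intro mult_left_mono) (auto simp: field_simps)
  also have "\<dots> \<le> (\<Sum>n\<in>mode_range \<rho> h. (mode_freq \<rho> n + 1) powr (\<epsilon> - 1))"
    using b(2) h \<epsilon> powr_diff_le
    by (intro sum_mode_range_ge) (auto intro!: divide_right_mono powr_mono2)
  finally have sum: "\<rho> / (2 * pi) * (h powr \<epsilon> / (2 * \<epsilon>))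
      \<le> (\<Sum>n\<in>mode_range \<rho> h. (mode_freq \<rho> n + 1) powr (\<epsilon> - 1))" .
  \<comment> \<open>The constant is \<open>1 / (4 * 5/3)\<close>: the 4 comes from the halves in
    \<open>s\<close> and \<open>h\<close>, and 5/3 from
    \<open>ln \<rho> \<le> 5/3 ln R\<close>.\<close>
  have "\<gamma> * R / ln R * (3 / 20) \<le> s * h"
  proof -
    have "s * h = \<gamma> * R / (4 * ln \<rho>)"
      using \<gamma> by (simp add: s_def h_def \<rho>_def)
    moreover have "\<gamma> * R / (4 * (5 / 3 * ln R)) \<le> \<gamma> * R / (4 * ln \<rho>)"
      using ln \<gamma> b(1) by (intro divide_left_mono) auto
    ultimately show ?thesis by simp
  qed
  then have "(\<gamma> * R / ln R * (3 / 20)) powr \<epsilon> \<le> (s * h) powr \<epsilon>"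
    using \<gamma> b(1) ln \<epsilon> by (intro powr_mono2) auto
  moreover have "(\<gamma> * R / ln R * (3 / 20)) powr \<epsilon> = (\<gamma> * R) powr \<epsilon> / ln R powr \<epsilon> * (3 / 20) powr \<epsilon>"
    using \<gamma> b(1) ln by (simp add: powr_mult powr_divide)
  \<comment> \<open>A number in (0,1) does not decrease when raised to a power
    \<open>\<epsilon> < 1\<close>.\<close>
  moreover have "(\<gamma> * R) powr \<epsilon> / ln R powr \<epsilon> * (3 / 20) \<le> (\<gamma> * R) powr \<epsilon> / ln R powr \<epsilon> * (3 / 20) powr \<epsilon>"
    using powr_mono'[of \<epsilon> 1 "3 / 20 :: real"] \<epsilon> by (intro mult_left_mono) auto
  ultimately have sh: "(\<gamma> * R) powr \<epsilon> / ln R powr \<epsilon> * (3 / 20) \<le> s powr \<epsilon> * h powr \<epsilon>"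
    using s h by (simp add: powr_mult)
  have "1 / (256 * pi * \<epsilon>) * (\<gamma> * R) powr (1 + \<epsilon>) / ln R powr \<epsilon>
      = \<gamma> * R / (pi * \<epsilon>) * ((\<gamma> * R) powr \<epsilon> / ln R powr \<epsilon> * (1 / 256))"
    using \<gamma> b(1) by (simp add: powr_add)
  \<comment> \<open>Only \<open>1/256 \<le> 3/80\<close> is used here.\<close>
  also have "\<dots> \<le> \<gamma> * R / (pi * \<epsilon>) * ((\<gamma> * R) powr \<epsilon> / ln R powr \<epsilon> * (3 / 20) / 4)"
    using \<gamma> b(1) \<epsilon> by (intro mult_left_mono) (auto simp: field_simps)
  also have "\<dots> \<le> \<gamma> * R / (pi * \<epsilon>) * (s powr \<epsilon> * h powr \<epsilon> / 4)"
    using \<gamma> b(1) \<epsilon> sh by (intro mult_left_mono divide_right_mono) auto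
  also have "\<dots> = (\<gamma> / 2) * s powr (\<epsilon> - 1) * (\<rho> / (2 * pi) * (h powr \<epsilon> / (2 * \<epsilon>)))"
  proof -
    have "s powr (\<epsilon> - 1) = s powr \<epsilon> / s" using s by (simp add: powr_diff)
    moreover have "\<rho> = 2 * s * R" by (simp add: \<rho>_def s_def)
    ultimately show ?thesis using s(1) \<epsilon> unfolding s(2) by (simp add: field_simps)
  qed
  also have "\<dots> \<le> (\<gamma> / 2) * s powr (\<epsilon> - 1) * (\<Sum>n\<in>mode_range \<rho> h. (mode_freq \<rho> n + 1) powr (\<epsilon> - 1))"
    using sum \<gamma> by (intro mult_left_mono) auto
  also have "\<dots> = (\<Sum>n\<in>mode_range \<rho> h. (\<gamma> / 2) * s powr (\<epsilon> - 1) * (mode_freq \<rho> n + 1) powr (\<epsilon> - 1))"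
    by (simp add: sum_distrib_left)
  finally show ?thesis
    using S_eps_ge_sum[of \<gamma> R \<epsilon>] \<gamma> b(2) \<epsilon>(2) unfolding \<rho>_def h_def s_def
    by (auto intro: order_trans ennreal_leI)
qed

theorem theorem2p8:
  fixes \<gamma> R :: real
  assumes "\<gamma> > 0"
    and "R \<ge> 600 * (\<gamma> powr (3/4) + \<gamma> powr (-3/4))"
  shows "S_eps 0 \<gamma> R \<ge> ennreal (\<gamma> * R / (16 * pi) * ln R) \<and>
         (\<forall>\<epsilon>::real. 0 < \<epsilon> \<and> \<epsilon> < 1 \<and>
           R \<ge> 4 / (exp 2 * \<gamma>) * (64 * pi) powr (2 / \<epsilon>) + 1 \<longrightarrow>
           S_eps \<epsilon> \<gamma> R \<ge> ennreal (1 / (256 * pi * \<epsilon>) * (\<gamma> * R) powr (1 + \<epsilon>) / (ln R) powr \<epsilon>))"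
  using S_0_ge[OF assms] S_eps_ge[OF assms] by blast

end
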